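(* Let $G$ be a locally compact group whose identity component $G_0$ is non-compact, and let $H$ be a compact subgroup of $G$. Let $\pi$ be an irreducible square integrable representation of the homogeneous space $G/H$ on a Hilbert space $\mathcal{H}_\pi$, and let $\xi\in\mathcal{H}_\pi$ be an admissible wavelet for $\pi$. Then for every $\eta\in\mathcal{H}_\pi\setminus\{0\}$ the set $\{gH\in G/H : W_\xi\eta(gH)\neq 0\}$ has infinite $\mu_{G/H}$-measure.
   Context: Let $G$ be a locally compact group, $H$ a compact subgroup and $G/H$ the left coset space with the quotient topology, on which $G$ acts by $(g,aH)\mapsto gaH$. The rho function is taken to be $\rho\equiv 1$, so that $\mu_{G/H}$ is a (nonzero Radon) $G$-invariant measure on $G/H$: $d\mu_{G/H}(saH)=d\mu_{G/H}(aH)$ for all $s\in G$. A continuous unitary representation of $G/H$ on a Hilbert space $\mathcal{H}_\pi$ is a map $\pi$ from $G/H$ into the group of unitary operators on $\mathcal{H}_\pi$ such that $gH\mapsto\langle\pi(gH)\xi,\eta\rangle$ is continuous on $G/H$ for all $\xi,\eta\in\mathcal{H}_\pi$, and $\pi(gkH)=\pi(gH)\pi(kH)$, $\pi(g^{-1}H)=\pi(gH)^*$ for all $g,k\in G$. Inner products are linear in the first variable. A vector $\xi\in\mathcal{H}_\pi$ is an admissible wavelet for $\pi$ if $0<C_\xi<\infty$, where $C_\xi=\int_{G/H}|\langle\xi,\pi(gH)\xi\rangle|^2\,d\mu_{G/H}(gH)$; $\pi$ is square integrable if an admissible wavelet exists. The continuous wavelet transform associated with $\xi$ is $(W_\xi\eta)(gH)=\langle\eta,\pi(gH)\xi\rangle$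 for $\eta\in\mathcal{H}_\pi$, $gH\in G/H$. *)

theory Defs
  imports "HOL-Analysis.Analysis" "HOL-Algebra.Left_Coset"
begin

section \<open>Complex Hilbert spaces\<close>

text \<open>
  The inner product is linear in the first variable. The underlying real Banach space structure
  (and with it the norm topology) is the one of the superclass; \<open>cinner_self\<close> says that the norm
  is the one induced by the inner product, and so contains positive definiteness.
\<close>

class chilbert_space = banach +
  fixes scaleC :: "complex \<Rightarrow> 'a \<Rightarrow> 'a" (infixr \<open>*\<^sub>C\<close> 75)
    and cinner :: "'a \<Rightarrow> 'a \<Rightarrow> complex"
  assumes scaleC_add_right: "a *\<^sub>C (x + y) = a *\<^sub>C x + a *\<^sub>C y"
    and scaleC_add_left: "(a + b) *\<^sub>C x = a *\<^sub>C x + b *\<^sub>C x"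
    and scaleC_scaleC: "a *\<^sub>C b *\<^sub>C x = (a * b) *\<^sub>C x"
    and scaleR_scaleC: "r *\<^sub>R x = complex_of_real r *\<^sub>C x"
    and cinner_add_left: "cinner (x + y) z = cinner x z + cinner y z"
    and cinner_scaleC_left: "cinner (a *\<^sub>C x) y = a * cinner x y"
    and cinner_commute: "cinner x y = cnj (cinner y x)"
    and cinner_self: "cinner x x = complex_of_real ((norm x)\<^sup>2)"

lemma vector_space_scaleC: "vector_space (scaleC :: complex \<Rightarrow> 'h::chilbert_space \<Rightarrow> 'h)"
proof
  show "1 *\<^sub>C x = x" for x :: 'h
    by (metis of_real_1 scaleR_one scaleR_scaleC)
qed (simp_all add: scaleC_add_right scaleC_add_left scaleC_scaleC)

definition unitary_operator :: "('h::chilbert_space \<Rightarrow> 'h) \<Rightarrow> bool" where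
  "unitary_operator U \<longleftrightarrow>
     Vector_Spaces.linear scaleC scaleC U \<and> surj U \<and> (\<forall>x y. cinner (U x) (U y) = cinner x y)"

definition cadjoint :: "('h::chilbert_space \<Rightarrow> 'h) \<Rightarrow> 'h \<Rightarrow> 'h" where
  "cadjoint T = (SOME T'. \<forall>x y. cinner (T x) y = cinner x (T' y))"

section \<open>Locally compact groups and their homogeneous spaces\<close>

locale topological_group = group G for G :: "('g, 'm) monoid_scheme" (structure) +
  fixes T :: "'g topology"
  assumes topspace_eq_carrier: "topspace T = carrier G"
    and continuous_map_mult: "continuous_map (prod_topology T T) T (\<lambda>(x, y). x \<otimes> y)"
    and continuous_map_inv: "continuous_map T T (\<lambda>x. inv x)"

locale locally_compact_group = topological_group +
  assumes Hausdorff: "Hausdorff_space T"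
    and locally_compact: "locally_compact_space T"

definition identity_component :: "('g, 'm) monoid_scheme \<Rightarrow> 'g topology \<Rightarrow> 'g set" where
  "identity_component G T = connected_component_of_set T \<one>\<^bsub>G\<^esub>"

definition coset_topology :: "('g, 'm) monoid_scheme \<Rightarrow> 'g topology \<Rightarrow> 'g set \<Rightarrow> 'g set topology" where
  "coset_topology G T H =
     topology (\<lambda>U. U \<subseteq> lcosets\<^bsub>G\<^esub> H \<and> openin T {g \<in> carrier G. g <#\<^bsub>G\<^esub> H \<in> U})"

lemma (in topological_group) openin_coset_topology:
  "openin (coset_topology G T H) U \<longleftrightarrow>
     U \<subseteq> lcosets H \<and> openin T {g \<in> carrier G. g <# H \<in> U}"
proof -
  have "istopology (\<lambda>U. U \<subseteq> lcosets H \<and> openin T {g \<in> carrier G. g <# H \<in> U})"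
    unfolding istopology_def
  proof (intro conjI allI impI)
    fix A B
    assume "A \<subseteq> lcosets H \<and> openin T {g \<in> carrier G. g <# H \<in> A}"
      and "B \<subseteq> lcosets H \<and> openin T {g \<in> carrier G. g <# H \<in> B}"
    moreover have "{g \<in> carrier G. g <# H \<in> A \<inter> B} =
        {g \<in> carrier G. g <# H \<in> A} \<inter> {g \<in> carrier G. g <# H \<in> B}"
      by auto
    ultimately show "A \<inter> B \<subseteq> lcosets H" "openin T {g \<in> carrier G. g <# H \<in> A \<inter> B}"
      by auto
  next
    fix K
    assume K: "\<forall>A\<in>K. A \<subseteq> lcosets H \<and> openin T {g \<in> carrier G. g <# H \<in> A}"
    then show "\<Union>K \<subseteq> lcosets H"
      by auto
    have "{g \<in> carrier G. g <# H \<in> \<Union>K} = (\<Union>A\<in>K. {g \<in> carrier G. g <# H \<in> A})"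
      by auto
    then show "openin T {g \<in> carrier G. g <# H \<in> \<Union>K}"
      using K by auto
  qed
  then show ?thesis
    by (simp add: coset_topology_def)
qed

lemma (in topological_group) topspace_coset_topology: "topspace (coset_topology G T H) = lcosets H"
proof -
  have "{g \<in> carrier G. g <# H \<in> lcosets H} = topspace T"
    by (auto simp: LCOSETS_def topspace_eq_carrier)
  then have "openin (coset_topology G T H) (lcosets H)"
    by (simp add: openin_coset_topology)
  then show ?thesis
    by (metis openin_coset_topology openin_subset openin_topspace subset_antisym)
qed

lemma (in topological_group) quotient_map_coset_topology:
  "quotient_map T (coset_topology G T H) (\<lambda>g. g <# H)"
  unfolding quotient_map_def topspace_coset_topology
  by (auto simp: openin_coset_topology topspace_eq_carrier LCOSETS_def)

section \<open>Invariant Radon measures\<close>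

text \<open>
  A Radon measure is a Borel measure that is finite on compact sets, outer regular on Borel sets
  and inner regular on open sets.
\<close>

definition radon_measure :: "'a topology \<Rightarrow> 'a measure \<Rightarrow> bool" where
  "radon_measure X M \<longleftrightarrow>
     space M = topspace X \<and>
     sets M = sigma_sets (topspace X) {U. openin X U} \<and>
     (\<forall>K. compactin X K \<longrightarrow> emeasure M K < \<infinity>) \<and>
     (\<forall>A\<in>sets M. emeasure M A = (INF U\<in>{U. openin X U \<and> A \<subseteq> U}. emeasure M U)) \<and>
     (\<forall>U. openin X U \<longrightarrow> emeasure M U = (SUP K\<in>{K. compactin X K \<and> K \<subseteq> U}. emeasure M K))"

definition invariant_radon_measure ::
    "('g, 'm) monoid_scheme \<Rightarrow> 'g topology \<Rightarrow> 'g set \<Rightarrow> 'g set measure \<Rightarrow> bool" where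
  "invariant_radon_measure G T H \<mu> \<longleftrightarrow>
     radon_measure (coset_topology G T H) \<mu> \<and>
     emeasure \<mu> (space \<mu>) \<noteq> 0 \<and>
     (\<forall>s\<in>carrier G. \<forall>A\<in>sets \<mu>. emeasure \<mu> ((\<lambda>C. s <#\<^bsub>G\<^esub> C) ` A) = emeasure \<mu> A)"

section \<open>Representations of homogeneous spaces and the wavelet transform\<close>

text \<open>
  Representations are functions on cosets; only their values on \<open>lcosets\<^bsub>G\<^esub> H\<close> matter.
\<close>

definition unitary_rep ::
    "('g, 'm) monoid_scheme \<Rightarrow> 'g topology \<Rightarrow> 'g set \<Rightarrow> ('g set \<Rightarrow> 'h::chilbert_space \<Rightarrow> 'h) \<Rightarrow> bool" where
  "unitary_rep G T H \<pi> \<longleftrightarrow>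
     (\<forall>C\<in>lcosets\<^bsub>G\<^esub> H. unitary_operator (\<pi> C)) \<and>
     (\<forall>\<xi> \<eta>. continuous_map (coset_topology G T H) euclidean (\<lambda>C. cinner (\<pi> C \<xi>) \<eta>)) \<and>
     (\<forall>g\<in>carrier G. \<forall>k\<in>carrier G.
        \<pi> ((g \<otimes>\<^bsub>G\<^esub> k) <#\<^bsub>G\<^esub> H) = \<pi> (g <#\<^bsub>G\<^esub> H) \<circ> \<pi> (k <#\<^bsub>G\<^esub> H)) \<and>
     (\<forall>g\<in>carrier G. \<pi> ((inv\<^bsub>G\<^esub> g) <#\<^bsub>G\<^esub> H) = cadjoint (\<pi> (g <#\<^bsub>G\<^esub> H)))"

definition irreducible_rep ::
    "('g, 'm) monoid_scheme \<Rightarrow> 'g set \<Rightarrow> ('g set \<Rightarrow> 'h::chilbert_space \<Rightarrow> 'h) \<Rightarrow> bool" where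
  "irreducible_rep G H \<pi> \<longleftrightarrow>
     (\<forall>S. module.subspace scaleC S \<and> closed S \<and> (\<forall>C\<in>lcosets\<^bsub>G\<^esub> H. \<pi> C ` S \<subseteq> S)
        \<longrightarrow> S = {0} \<or> S = UNIV)"

definition wavelet_const ::
    "'g set measure \<Rightarrow> ('g set \<Rightarrow> 'h::chilbert_space \<Rightarrow> 'h) \<Rightarrow> 'h \<Rightarrow> ennreal" where
  "wavelet_const \<mu> \<pi> \<xi> = (\<integral>\<^sup>+ C. ennreal ((cmod (cinner \<xi> (\<pi> C \<xi>)))\<^sup>2) \<partial>\<mu>)"

definition admissible_wavelet ::
    "'g set measure \<Rightarrow> ('g set \<Rightarrow> 'h::chilbert_space \<Rightarrow> 'h) \<Rightarrow> 'h \<Rightarrow> bool" where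
  "admissible_wavelet \<mu> \<pi> \<xi> \<longleftrightarrow> 0 < wavelet_const \<mu> \<pi> \<xi> \<and> wavelet_const \<mu> \<pi> \<xi> < \<infinity>"

definition square_integrable_rep ::
    "'g set measure \<Rightarrow> ('g set \<Rightarrow> 'h::chilbert_space \<Rightarrow> 'h) \<Rightarrow> bool" where
  "square_integrable_rep \<mu> \<pi> \<longleftrightarrow> (\<exists>\<xi>. admissible_wavelet \<mu> \<pi> \<xi>)"

definition wavelet_transform ::
    "('g set \<Rightarrow> 'h::chilbert_space \<Rightarrow> 'h) \<Rightarrow> 'h \<Rightarrow> 'h \<Rightarrow> 'g set \<Rightarrow> complex" where
  "wavelet_transform \<pi> \<xi> \<eta> C = cinner \<eta> (\<pi> C \<xi>)"

end

theory Submission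
  imports Defs
begin

text \<open>
  Write \<open>W\<close> for the wavelet transform of \<open>\<xi>\<close>, and let \<open>E\<close> be the set where \<open>W \<eta>\<close> does not vanish.
  It is open. The theorem is an uncertainty principle: if \<open>E\<close> had finite measure, then infinitely
  many linearly independent transforms would fit into one set of finite measure, and there is no
  room for them there.

  \<^bold>\<open>No room.\<close> The orthogonality relations (\<open>orthogonality_relation\<close>) say that the integral of
  \<open>\<bar>W \<zeta>\<bar>\<^sup>2\<close> is \<open>c \<parallel>\<zeta>\<parallel>\<^sup>2\<close> with one constant \<open>c > 0\<close>. Bessel's inequality bounds the sum of \<open>\<bar>W e\<^sub>i\<bar>\<^sup>2\<close>
  over an orthonormal family pointwise by \<open>\<parallel>\<xi>\<parallel>\<^sup>2\<close>. Hence, if the transforms of \<open>n\<close> orthonormal vectors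
  live on \<open>A\<close>, integration gives \<open>n c \<le> \<parallel>\<xi>\<parallel>\<^sup>2 \<mu>(A)\<close> (\<open>trace_bound\<close>), which bounds \<open>n\<close>.

  \<^bold>\<open>Too many transforms.\<close> Translating \<open>\<eta>\<close> by \<open>s\<close> translates the support to \<open>s E\<close>. For an open set
  \<open>A \<supseteq> E\<close> of finite measure, \<open>s \<mapsto> \<mu>(s E - A)\<close> depends continuously on \<open>s\<close> and vanishes at the
  identity. It does not vanish on all of the identity component: a closed non-compact subset of \<open>G\<close>
  contains arbitrarily many elements that move a relatively compact piece of \<open>E\<close> to pairwise disjoint
  sets, which do not all fit into \<open>A\<close>. By connectedness it takes positive values below any prescribed
  \<open>\<epsilon>\<close> (\<open>small_escaping_translate\<close>). Enlarging \<open>A\<close> again and again by such small amounts yields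
  orthonormal families of every size, supported in sets of measure less than \<open>\<mu>(E) + 1\<close>.

  \<^bold>\<open>Orthogonality relations.\<close> By Fatou's lemma the energy \<open>\<integral>\<bar>W \<zeta>\<bar>\<^sup>2\<close> is a closed quadratic form,
  possibly infinite, and it is invariant under the representation. Schur's lemma for such forms
  (\<open>invariant_form_scalar\<close>) makes it a multiple of the squared norm. It is reduced to Schur's lemma
  for bounded self-adjoint operators by passing to the operator \<open>y \<mapsto> argmin\<^sub>x (\<parallel>x - y\<parallel>\<^sup>2 + q x)\<close>,
  which is the resolvent \<open>(1 + q)\<^sup>-\<^sup>1\<close>. The bounded case in turn rests on square roots: if \<open>A\<close> is
  self-adjoint and \<open>S\<close> is the positive root of \<open>A\<^sup>2\<close>, then \<open>(S - A)(S + A) = 0\<close>, and irreducibility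
  forces one factor to vanish, so every self-adjoint \<open>A\<close> in the commutant is semidefinite.
\<close>

section \<open>The real inner product of a complex Hilbert space\<close>

text \<open>
  The arguments about minimisers and positive operators compare real numbers, so they are carried out
  in the underlying real Hilbert space.
\<close>

definition rinner :: "'h::chilbert_space \<Rightarrow> 'h \<Rightarrow> real" where
  "rinner x y = Re (cinner x y)"

lemma cinner_scaleC_right: "cinner x (a *\<^sub>C y) = cnj a * cinner x (y :: 'h::chilbert_space)"
  by (metis cinner_commute cinner_scaleC_left complex_cnj_mult)

lemma cinner_scaleR_left: "cinner (r *\<^sub>R x) y = of_real r * cinner x (y :: 'h::chilbert_space)"
  by (simp add: scaleR_scaleC cinner_scaleC_left)

lemma cinner_minus_left: "cinner (- x) y = - cinner x (y :: 'h::chilbert_space)"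
  using cinner_scaleR_left[of "-1" x y] by simp

lemma cinner_diff_left: "cinner (x - y) z = cinner x z - cinner y (z :: 'h::chilbert_space)"
  using cinner_add_left[of x "- y" z] by (simp add: cinner_minus_left)

lemma cinner_zero_left [simp]: "cinner 0 y = (0 :: complex)" for y :: "'h::chilbert_space"
  using cinner_scaleR_left[of 0 0 y] by simp

lemma cinner_sum_left: "cinner (\<Sum>i\<in>I. f i) y = (\<Sum>i\<in>I. cinner (f i) (y :: 'h::chilbert_space))"
  by (induction I rule: infinite_finite_induct) (auto simp: cinner_add_left)

lemma rinner_commute: "rinner x y = rinner y (x :: 'h::chilbert_space)"
  unfolding rinner_def by (subst cinner_commute) simp

lemma rinner_add_left: "rinner (x + y) z = rinner x z + rinner y (z :: 'h::chilbert_space)"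
  by (simp add: rinner_def cinner_add_left)

lemma rinner_add_right: "rinner z (x + y) = rinner z x + rinner z (y :: 'h::chilbert_space)"
  by (metis rinner_add_left rinner_commute)

lemma rinner_scaleR_left: "rinner (r *\<^sub>R x) y = r * rinner x (y :: 'h::chilbert_space)"
  by (simp add: rinner_def cinner_scaleR_left)

lemma rinner_scaleR_right: "rinner x (r *\<^sub>R y) = r * rinner x (y :: 'h::chilbert_space)"
  by (metis rinner_scaleR_left rinner_commute)

lemma rinner_diff_left: "rinner (x - y) z = rinner x z - rinner y (z :: 'h::chilbert_space)"
  by (simp add: rinner_def cinner_diff_left)

lemma rinner_diff_right: "rinner z (x - y) = rinner z x - rinner z (y :: 'h::chilbert_space)"
  by (metis rinner_diff_left rinner_commute)

lemma rinner_self: "rinner x x = (norm (x :: 'h::chilbert_space))\<^sup>2"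
  by (simp add: rinner_def cinner_self)

lemmas rinner_simps = rinner_add_left rinner_add_right rinner_diff_left rinner_diff_right
  rinner_scaleR_left rinner_scaleR_right

lemma norm_diff_sq:
  "(norm (x - y))\<^sup>2 = (norm x)\<^sup>2 - 2 * rinner x y + (norm (y :: 'h::chilbert_space))\<^sup>2"
  unfolding rinner_self[symmetric] by (simp add: rinner_simps rinner_commute[of y x])

lemma norm_parallelogram:
  "(norm (x + y))\<^sup>2 + (norm (x - y))\<^sup>2 = 2 * (norm x)\<^sup>2 + 2 * (norm (y :: 'h::chilbert_space))\<^sup>2"
  unfolding rinner_self[symmetric] by (simp add: rinner_simps)

text \<open>
  Expand the squared distance from \<open>x\<close> to its projection \<open>p\<close> onto the span of the family, using
  \<open>\<langle>p, p\<rangle> = \<langle>p, x\<rangle>\<close>.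
\<close>

lemma bessel_inequality:
  fixes e :: "nat \<Rightarrow> 'h::chilbert_space"
  assumes orth: "\<And>i j. i < n \<Longrightarrow> j < n \<Longrightarrow> cinner (e i) (e j) = (if i = j then 1 else 0)"
  shows "(\<Sum>i<n. (cmod (cinner (e i) x))\<^sup>2) \<le> (norm x)\<^sup>2"
proof -
  define p where "p = (\<Sum>i<n. cinner x (e i) *\<^sub>C e i)"
  have px: "cinner p x = (\<Sum>i<n. of_real ((cmod (cinner (e i) x))\<^sup>2))"
    unfolding p_def cinner_sum_left cinner_scaleC_left
    by (intro sum.cong refl)
      (metis cinner_commute complex_norm_square mult.commute of_real_power)
  have pe: "cinner p (e j) = cinner x (e j)" if "j < n" for j
    unfolding p_def cinner_sum_left cinner_scaleC_left
    using that by (simp add: orth if_distrib cong: if_cong)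
  have "cinner p p = (\<Sum>i<n. cinner x (e i) * cinner (e i) p)"
    by (subst (1) p_def) (simp add: cinner_sum_left cinner_scaleC_left)
  also have "\<dots> = (\<Sum>i<n. cinner x (e i) * cinner (e i) x)"
    by (intro sum.cong refl arg_cong2[where f = "(*)"]) (metis pe cinner_commute lessThan_iff)
  also have "\<dots> = cinner p x"
    unfolding p_def by (simp add: cinner_sum_left cinner_scaleC_left)
  finally have pp: "cinner p p = cinner p x" .
  have "0 \<le> (norm (p - x))\<^sup>2"
    by simp
  also have "\<dots> = (norm x)\<^sup>2 - rinner p x"
    using pp unfolding norm_diff_sq by (simp add: rinner_def flip: rinner_self)
  finally show ?thesis
    using px by (simp add: rinner_def)
qed

lemma cinner_cauchy_schwarz: "cmod (cinner x y) \<le> norm x * norm (y :: 'h::chilbert_space)"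
proof (cases "x = 0")
  case False
  define e where "e = (1 / norm x) *\<^sub>R x"
  have "cinner e e = 1"
    unfolding cinner_self e_def using False by simp
  then have "(cmod (cinner e y))\<^sup>2 \<le> (norm y)\<^sup>2"
    using bessel_inequality[of 1 "\<lambda>_. e" y] by simp
  then have "cmod (cinner e y) \<le> norm y"
    by (rule power2_le_imp_le) simp
  then show ?thesis
    using False by (simp add: e_def cinner_scaleR_left norm_mult norm_divide field_simps)
qed simp

lemma rinner_le_norm: "rinner x y \<le> norm x * norm (y :: 'h::chilbert_space)"
  unfolding rinner_def using cinner_cauchy_schwarz[of x y] complex_Re_le_cmod order_trans by blast

lemma norm_scaleC: "norm (a *\<^sub>C x) = cmod a * norm (x :: 'h::chilbert_space)"
proof -
  have "complex_of_real ((norm (a *\<^sub>C x))\<^sup>2) = a * cnj a * cinner x x"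
    by (simp only: cinner_self[symmetric] cinner_scaleC_left cinner_scaleC_right ac_simps)
  also have "\<dots> = of_real ((cmod a * norm x)\<^sup>2)"
    by (simp only: cinner_self complex_mult_cnj) (simp add: power_mult_distrib cmod_power2)
  finally have "(norm (a *\<^sub>C x))\<^sup>2 = (cmod a * norm x)\<^sup>2"
    using of_real_eq_iff by blast
  then show ?thesis
    by (simp add: power2_eq_iff_nonneg)
qed

lemma scaleC_diff_right: "a *\<^sub>C (x - y) = a *\<^sub>C x - a *\<^sub>C (y :: 'h::chilbert_space)"
  by (metis add_diff_cancel diff_add_cancel scaleC_add_right)

lemma scaleC_zero_right [simp]: "a *\<^sub>C 0 = (0 :: 'h::chilbert_space)"
  using norm_scaleC[of a "0 :: 'h"] by simp

lemma scaleC_zero_left [simp]: "0 *\<^sub>C x = (0 :: 'h::chilbert_space)"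
  using norm_scaleC[of 0 x] by simp

lemma bounded_linear_scaleC: "bounded_linear (\<lambda>x :: 'h::chilbert_space. a *\<^sub>C x)"
  by (rule bounded_linear_intro[of _ "cmod a"])
    (auto simp: scaleC_add_right norm_scaleC scaleR_scaleC scaleC_scaleC mult.commute)

lemma unitary_operator_isometry:
  assumes "unitary_operator U"
  shows unitary_operator_add: "U (x + y) = U x + U y"
    and unitary_operator_diff: "U (x - y) = U x - U y"
    and unitary_operator_surj: "surj U"
    and unitary_operator_norm: "norm (U x) = norm x"
    and unitary_operator_bounded_linear: "bounded_linear U"
proof -
  have "vector_space (scaleC :: complex \<Rightarrow> 'a \<Rightarrow> 'a)"
    by (rule vector_space_scaleC)
  then interpret vector_space_pair "scaleC :: complex \<Rightarrow> 'a \<Rightarrow> 'a" "scaleC :: complex \<Rightarrow> 'a \<Rightarrow> 'a"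
    by (simp add: vector_space_pair_def)
  show add: "U (x + y) = U x + U y" for x y
    using assms by (simp add: unitary_operator_def linear_add)
  show "U (x - y) = U x - U y" for x y
    using assms by (simp add: unitary_operator_def linear_diff)
  show "surj U"
    using assms by (simp add: unitary_operator_def)
  show norm: "norm (U x) = norm x" for x
  proof -
    have "(norm (U x))\<^sup>2 = (norm x)\<^sup>2"
      using assms by (simp add: unitary_operator_def rinner_def flip: rinner_self)
    then show ?thesis
      by (simp add: power2_eq_iff_nonneg)
  qed
  have "U (r *\<^sub>R x) = r *\<^sub>R U x" for r x
    using assms by (simp add: unitary_operator_def linear_scale scaleR_scaleC)
  then show "bounded_linear U"
    by (intro bounded_linear_intro[of _ 1]) (simp_all add: add norm)
qed

text \<open>
  First-order condition at a minimum: the linear term of a quadratic inequality that is valid for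
  all \<open>t\<close> vanishes.
\<close>

lemma zero_if_linear_le_quadratic:
  fixes a b :: real
  assumes "\<And>t. t * a \<le> t\<^sup>2 * b"
  shows "a = 0"
proof (rule ccontr)
  assume "a \<noteq> 0"
  \<comment> \<open>small enough for the linear term to dominate\<close>
  define t where "t = a / (\<bar>b\<bar> + 1)"
  have "t * a \<le> t\<^sup>2 * b"
    by (rule assms)
  also have "\<dots> \<le> t\<^sup>2 * \<bar>b\<bar>"
    by (intro mult_left_mono) auto
  also have "\<dots> < t\<^sup>2 * (\<bar>b\<bar> + 1)"
    using \<open>a \<noteq> 0\<close> by (intro mult_strict_left_mono) (auto simp: t_def)
  also have "\<dots> = t * a"
    by (simp add: t_def power2_eq_square)
  finally show False
    by simp
qed

section \<open>Square roots of operators\<close>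

text \<open>
  The fixed points of \<open>X = (B + X\<^sup>2) / 2\<close> satisfy \<open>(1 - X)\<^sup>2 = 1 - B\<close>. Iterating this equation from
  \<open>0\<close> produces polynomials in \<open>B\<close>, so the limit commutes with whatever commutes with \<open>B\<close>.
\<close>

fun sqrt_iter :: "('a::real_normed_vector \<Rightarrow> 'a) \<Rightarrow> nat \<Rightarrow> 'a \<Rightarrow> 'a" where
  "sqrt_iter B 0 x = 0"
| "sqrt_iter B (Suc n) x = (1/2) *\<^sub>R (B x + sqrt_iter B n (sqrt_iter B n x))"

text \<open>
  The scalar iteration for \<open>B = 1\<close>. It increases, stays below \<open>1\<close>, and majorises the operator
  iteration for every contraction \<open>B\<close>.
\<close>

fun sqrt_bound :: "nat \<Rightarrow> real" where
  "sqrt_bound 0 = 0"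
| "sqrt_bound (Suc n) = (1 + (sqrt_bound n)\<^sup>2) / 2"

lemma sqrt_bound_range: "0 \<le> sqrt_bound n \<and> sqrt_bound n \<le> 1"
  by (induction n) (auto simp: power_le_one)

lemma sqrt_bound_incseq: "incseq sqrt_bound"
proof (rule incseq_SucI)
  fix n
  have "0 \<le> (1 - sqrt_bound n)\<^sup>2"
    by simp
  then show "sqrt_bound n \<le> sqrt_bound (Suc n)"
    by (simp add: power2_diff)
qed

lemma bounded_linear_sqrt_iter:
  assumes "bounded_linear B"
  shows "bounded_linear (sqrt_iter B n)"
proof (induction n)
  case 0
  show ?case
    by (rule bounded_linear_intro[of _ 0]) simp_all
next
  case (Suc n)
  have "bounded_linear (\<lambda>x. (1/2) *\<^sub>R (B x + sqrt_iter B n (sqrt_iter B n x)))"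
    by (intro bounded_linear_const_scaleR bounded_linear_add assms bounded_linear_compose[OF Suc Suc])
  moreover have "sqrt_iter B (Suc n) = (\<lambda>x. (1/2) *\<^sub>R (B x + sqrt_iter B n (sqrt_iter B n x)))"
    by (rule ext) simp
  ultimately show ?case
    by simp
qed

lemma sqrt_iter_commutes:
  assumes "bounded_linear A" "\<And>x. A (B x) = B (A x)"
  shows "A (sqrt_iter B n x) = sqrt_iter B n (A x)"
proof (induction n arbitrary: x)
  case 0
  then show ?case
    by (simp add: linear_simps[OF assms(1)])
next
  case (Suc n)
  show ?case
    by (simp add: linear_simps[OF assms(1)] assms(2) Suc)
qed

lemma sqrt_iter_norm:
  assumes "\<And>x. norm (B x) \<le> norm x"
  shows "norm (sqrt_iter B n x) \<le> sqrt_bound n * norm x"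
proof (induction n arbitrary: x)
  case (Suc n)
  have "norm (B x + sqrt_iter B n (sqrt_iter B n x))
      \<le> norm x + sqrt_bound n * norm (sqrt_iter B n x)"
    by (intro norm_triangle_mono assms Suc)
  also have "\<dots> \<le> norm x + sqrt_bound n * (sqrt_bound n * norm x)"
    using sqrt_bound_range by (intro add_mono mult_left_mono Suc) auto
  finally show ?case
    by (simp only: sqrt_iter.simps sqrt_bound.simps norm_scaleR)
      (simp add: power2_eq_square algebra_simps)
qed simp

text \<open>
  The iterates commute with each other, so the difference of two squares factors:
  \<open>X\<^sub>n\<^sub>+\<^sub>2 - X\<^sub>n\<^sub>+\<^sub>1 = (X\<^sub>n\<^sub>+\<^sub>1 + X\<^sub>n)(X\<^sub>n\<^sub>+\<^sub>1 - X\<^sub>n) / 2\<close>. The scalar iteration obeys the same recursion, which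
  carries the bound along.
\<close>

lemma sqrt_iter_step:
  assumes "bounded_linear B" "\<And>x. norm (B x) \<le> norm x"
  shows "norm (sqrt_iter B (Suc n) x - sqrt_iter B n x)
    \<le> (sqrt_bound (Suc n) - sqrt_bound n) * norm x"
proof (induction n arbitrary: x)
  case 0
  show ?case
    using assms(2)[of x] by simp
next
  case (Suc n)
  let ?X = "sqrt_iter B"
  define d where "d = ?X (Suc n) x - ?X n x"
  note lin = bounded_linear_sqrt_iter[OF assms(1)]
  have comm: "?X n (?X (Suc n) x) = ?X (Suc n) (?X n x)"
    by (intro sqrt_iter_commutes lin sqrt_iter_commutes[symmetric] assms(1)) simp
  have "?X (Suc (Suc n)) x - ?X (Suc n) x =
      (1/2) *\<^sub>R (?X (Suc n) (?X (Suc n) x) - ?X n (?X n x))"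
    by (simp only: sqrt_iter.simps(2)[of _ "Suc n"] sqrt_iter.simps(2)[of _ n x])
      (simp add: algebra_simps)
  also have "?X (Suc n) (?X (Suc n) x) - ?X n (?X n x) = ?X (Suc n) d + ?X n d"
    unfolding d_def by (simp only: linear_simps[OF lin] comm) simp
  finally have "norm (?X (Suc (Suc n)) x - ?X (Suc n) x) = norm (?X (Suc n) d + ?X n d) / 2"
    by simp
  also have "\<dots> \<le> (sqrt_bound (Suc n) * norm d + sqrt_bound n * norm d) / 2"
    by (intro divide_right_mono norm_triangle_mono sqrt_iter_norm assms(2)) simp
  also have "\<dots> = (sqrt_bound (Suc n) + sqrt_bound n) / 2 * norm d"
    by argo
  also have "\<dots> \<le> (sqrt_bound (Suc n) + sqrt_bound n) / 2 *
      ((sqrt_bound (Suc n) - sqrt_bound n) * norm x)"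
    unfolding d_def using sqrt_bound_range by (intro mult_left_mono Suc divide_nonneg_nonneg add_nonneg_nonneg) auto
  also have "\<dots> = (sqrt_bound (Suc (Suc n)) - sqrt_bound (Suc n)) * norm x"
    by (simp only: sqrt_bound.simps(2)[of "Suc n"] sqrt_bound.simps(2)[of n])
      (simp add: power2_eq_square field_simps)
  finally show ?case .
qed

lemma sqrt_iter_dist:
  assumes "bounded_linear B" "\<And>x. norm (B x) \<le> norm x" "m \<le> n"
  shows "norm (sqrt_iter B n x - sqrt_iter B m x) \<le> (sqrt_bound n - sqrt_bound m) * norm x"
  using assms(3)
proof (induction n rule: dec_induct)
  case (step n)
  have "norm (sqrt_iter B (Suc n) x - sqrt_iter B m x) \<le>
      norm (sqrt_iter B (Suc n) x - sqrt_iter B n x) + norm (sqrt_iter B n x - sqrt_iter B m x)"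
    using norm_triangle_ineq[of "sqrt_iter B (Suc n) x - sqrt_iter B n x"
        "sqrt_iter B n x - sqrt_iter B m x"] by (simp only: diff_add_cancel add_diff_eq)
  also have "\<dots> \<le> (sqrt_bound (Suc n) - sqrt_bound n) * norm x + (sqrt_bound n - sqrt_bound m) * norm x"
    by (intro add_mono step.IH sqrt_iter_step assms)
  finally show ?case
    by (simp only: left_diff_distrib)
qed simp

text \<open>
  Here \<open>X\<close> is \<open>1 - \<surd>(1 - B)\<close>. That \<open>X\<close> is again a contraction is what makes \<open>1 - X\<close> a positive
  operator on a Hilbert space.
\<close>

lemma complementary_sqrt_exists:
  fixes B :: "'a::banach \<Rightarrow> 'a"
  assumes B: "bounded_linear B" "\<And>x. norm (B x) \<le> norm x"
  obtains X where "bounded_linear X" "\<And>x. norm (X x) \<le> norm x"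
    "\<And>x. 2 *\<^sub>R X x = B x + X (X x)"
    "\<And>A x. bounded_linear A \<Longrightarrow> (\<And>y. A (B y) = B (A y)) \<Longrightarrow> A (X x) = X (A x)"
proof -
  let ?X = "sqrt_iter B"
  note lin = bounded_linear_sqrt_iter[OF B(1)]
  obtain L where L: "sqrt_bound \<longlonglongrightarrow> L"
    using sqrt_bound_range by (auto intro: incseq_convergent[OF sqrt_bound_incseq, of 1])
  have "convergent (\<lambda>n. ?X n x)" for x
  proof -
    have "Cauchy (\<lambda>n. sqrt_bound n * norm x)"
      by (rule LIMSEQ_imp_Cauchy[OF tendsto_mult_right[OF L]])
    moreover have "dist (?X m x) (?X n x) \<le> dist (sqrt_bound m * norm x) (sqrt_bound n * norm x)" for m n
    proof -
      have "norm (?X n x - ?X m x) \<le> \<bar>sqrt_bound n * norm x - sqrt_bound m * norm x\<bar>"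
        using sqrt_iter_dist[OF B, of m n x] sqrt_iter_dist[OF B, of n m x]
          norm_minus_commute[of "?X n x" "?X m x"] by (cases "m \<le> n") (auto simp: algebra_simps)
      then show ?thesis
        by (simp add: dist_norm norm_minus_commute)
    qed
    ultimately have "Cauchy (\<lambda>n. ?X n x)"
      unfolding Cauchy_def by (meson le_less_trans)
    then show ?thesis
      by (rule Cauchy_convergent)
  qed
  then obtain X where X: "\<And>x. (\<lambda>n. ?X n x) \<longlonglongrightarrow> X x"
    unfolding convergent_def by metis
  have norm1: "norm (?X n x) \<le> norm x" for n x
    using sqrt_iter_norm[OF B(2), of n x] sqrt_bound_range[of n]
      mult_left_le_one_le[of "norm x" "sqrt_bound n"] by simp
  have normX: "norm (X x) \<le> norm x" for x
    by (rule LIMSEQ_le_const2[OF tendsto_norm[OF X]]) (use norm1 in auto)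
  show ?thesis
  proof
    show "bounded_linear X"
    proof (rule bounded_linear_intro[of _ 1])
      show "X (x + y) = X x + X y" for x y
        by (rule LIMSEQ_unique[OF X]) (unfold linear_simps[OF lin], intro tendsto_add X)
      show "X (r *\<^sub>R x) = r *\<^sub>R X x" for r x
        by (rule LIMSEQ_unique[OF X]) (unfold linear_simps[OF lin], intro tendsto_scaleR tendsto_const X)
    qed (simp add: normX)
    show "norm (X x) \<le> norm x" for x
      by (rule normX)
    show "2 *\<^sub>R X x = B x + X (X x)" for x
    proof (rule LIMSEQ_unique)
      show "(\<lambda>n. 2 *\<^sub>R ?X (Suc n) x) \<longlonglongrightarrow> 2 *\<^sub>R X x"
        by (intro tendsto_intros LIMSEQ_Suc X)
      have "(\<lambda>n. ?X n (?X n x - X x)) \<longlonglongrightarrow> 0"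
      proof (rule Lim_null_comparison)
        show "\<forall>\<^sub>F n in sequentially. norm (?X n (?X n x - X x)) \<le> norm (?X n x - X x)"
          using norm1 by simp
        show "(\<lambda>n. norm (?X n x - X x)) \<longlonglongrightarrow> 0"
          using X[of x] LIM_zero tendsto_norm_zero by blast
      qed
      then have "(\<lambda>n. ?X n (?X n x - X x) + ?X n (X x)) \<longlonglongrightarrow> 0 + X (X x)"
        by (intro tendsto_add X)
      then have "(\<lambda>n. ?X n (?X n x)) \<longlonglongrightarrow> X (X x)"
        by (simp add: linear_simps[OF lin])
      then show "(\<lambda>n. 2 *\<^sub>R ?X (Suc n) x) \<longlonglongrightarrow> B x + X (X x)"
        by (simp add: tendsto_add[OF tendsto_const])
    qed
    show "A (X x) = X (A x)" if A: "bounded_linear A" "\<And>y. A (B y) = B (A y)" for A x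
    proof (rule LIMSEQ_unique)
      show "(\<lambda>n. A (?X n x)) \<longlonglongrightarrow> A (X x)"
        by (intro bounded_linear.tendsto[OF A(1)] X)
      show "(\<lambda>n. A (?X n x)) \<longlonglongrightarrow> X (A x)"
        using sqrt_iter_commutes[of A B, OF A] X by simp
    qed
  qed
qed

section \<open>Schur's lemma for bounded operators\<close>

definition commutant_member :: "('h::chilbert_space \<Rightarrow> 'h) set \<Rightarrow> ('h \<Rightarrow> 'h) \<Rightarrow> bool" where
  "commutant_member \<U> A \<longleftrightarrow> bounded_linear A \<and> (\<forall>a x. A (a *\<^sub>C x) = a *\<^sub>C A x) \<and>
     (\<forall>U\<in>\<U>. \<forall>x. A (U x) = U (A x))"

definition irreducible_family :: "('h::chilbert_space \<Rightarrow> 'h) set \<Rightarrow> bool" where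
  "irreducible_family \<U> \<longleftrightarrow> (\<forall>U\<in>\<U>. bounded_linear U) \<and>
     (\<forall>S. module.subspace scaleC S \<and> closed S \<and> (\<forall>U\<in>\<U>. U ` S \<subseteq> S) \<longrightarrow> S = {0} \<or> S = UNIV)"

text \<open>
  The kernel of \<open>A\<close> is a closed invariant subspace, so it is everything as soon as it is nonzero.
\<close>

lemma commutant_member_kernel:
  assumes "irreducible_family \<U>" "commutant_member \<U> A" "A x = 0" "x \<noteq> 0"
  shows "A y = 0"
proof -
  interpret vector_space "scaleC :: complex \<Rightarrow> 'a \<Rightarrow> 'a"
    by (rule vector_space_scaleC)
  have A: "bounded_linear A" "\<And>a x. A (a *\<^sub>C x) = a *\<^sub>C A x"
    "\<And>U x. U \<in> \<U> \<Longrightarrow> A (U x) = U (A x)" "\<And>U. U \<in> \<U> \<Longrightarrow> bounded_linear U"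
    using assms(1,2) by (auto simp: commutant_member_def irreducible_family_def)
  let ?S = "A -` {0}"
  have "closed ?S"
    using A(1) by (intro closed_vimage) (auto intro: linear_continuous_on)
  moreover have "subspace ?S"
    by (rule subspaceI) (auto simp: A(2) linear_simps[OF A(1)])
  moreover have "\<forall>U\<in>\<U>. U ` ?S \<subseteq> ?S"
    using A(3) by (auto simp: linear_simps[OF A(4)])
  ultimately have "?S = {0} \<or> ?S = UNIV"
    using assms(1) by (auto simp: irreducible_family_def)
  then show ?thesis
    using assms(3,4) by auto
qed

text \<open>
  Scale \<open>A\<close> to a contraction \<open>A\<^sub>1\<close> and take the positive root \<open>S\<close> of \<open>A\<^sub>1\<^sup>2\<close>. It commutes with everything
  that commutes with \<open>A\<close>, hence \<open>(S - A\<^sub>1)(S + A\<^sub>1) = 0\<close> with both factors in the commutant. If the second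
  factor is nonzero, then the first one has a nontrivial kernel and vanishes. So \<open>A\<^sub>1 = S\<close> or
  \<open>A\<^sub>1 = - S\<close>.
\<close>

lemma commutant_member_semidefinite:
  fixes A :: "'h::chilbert_space \<Rightarrow> 'h"
  assumes irred: "irreducible_family \<U>" and A: "commutant_member \<U> A"
    and sa: "\<And>x y. rinner (A x) y = rinner x (A y)"
  shows "(\<forall>x. 0 \<le> rinner (A x) x) \<or> (\<forall>x. rinner (A x) x \<le> 0)"
proof -
  have linA: "bounded_linear A"
    using A by (simp add: commutant_member_def)
  obtain K where K: "K > 0" "\<And>x. norm (A x) \<le> K * norm x"
    using bounded_linear.pos_bounded[OF linA] by (metis mult.commute)
  define A1 where "A1 = (\<lambda>x. (1 / K) *\<^sub>R A x)"
  have lin1: "bounded_linear A1"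
    unfolding A1_def by (intro bounded_linear_const_scaleR linA)
  have norm1: "norm (A1 x) \<le> norm x" for x
    using K by (simp add: A1_def field_simps)
  have sa1: "rinner (A1 x) y = rinner x (A1 y)" for x y
    by (simp add: A1_def rinner_simps sa)
  define B where "B = (\<lambda>x. x - A1 (A1 x))"
  have linB: "bounded_linear B"
    unfolding B_def by (intro bounded_linear_sub bounded_linear_ident bounded_linear_compose[OF lin1 lin1])
  have normB: "norm (B x) \<le> norm x" for x
  proof (rule power2_le_imp_le)
    have "(norm (B x))\<^sup>2 = (norm x)\<^sup>2 - 2 * (norm (A1 x))\<^sup>2 + (norm (A1 (A1 x)))\<^sup>2"
      unfolding B_def norm_diff_sq by (simp add: sa1[symmetric] rinner_self)
    also have "\<dots> \<le> (norm x)\<^sup>2"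
      using power_mono[OF norm1[of "A1 x"] norm_ge_zero, of 2] zero_le_power2[of "norm (A1 x)"]
      by linarith
    finally show "(norm (B x))\<^sup>2 \<le> (norm x)\<^sup>2" .
  qed simp
  obtain X where X: "bounded_linear X" "\<And>x. norm (X x) \<le> norm x"
    "\<And>x. 2 *\<^sub>R X x = B x + X (X x)"
    "\<And>A x. bounded_linear A \<Longrightarrow> (\<And>y. A (B y) = B (A y)) \<Longrightarrow> A (X x) = X (A x)"
    using complementary_sqrt_exists[OF linB normB] by blast
  define S where "S = (\<lambda>x. x - X x)"
  have SS: "S (S x) = A1 (A1 x)" for x
  proof -
    have "S (S x) = x - (2 *\<^sub>R X x - X (X x))"
      by (simp add: S_def linear_simps[OF X(1)] scaleR_2)
    then show ?thesis
      by (simp add: X(3) B_def)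
  qed
  have linS: "bounded_linear S"
    unfolding S_def by (intro bounded_linear_sub bounded_linear_ident X(1))
  have S_pos: "0 \<le> rinner (S x) x" for x
  proof -
    have "rinner (X x) x \<le> norm x * norm x"
      by (rule order_trans[OF rinner_le_norm mult_right_mono[OF X(2)]]) simp
    then show ?thesis
      by (simp add: S_def rinner_simps rinner_self power2_eq_square)
  qed
  have S_comm: "V (S x) = S (V x)" if V: "bounded_linear V" "\<And>y. V (A y) = A (V y)" for V x
  proof -
    have "V (A1 y) = A1 (V y)" for y
      by (simp add: A1_def linear_simps[OF V(1)] V(2))
    then have "V (B y) = B (V y)" for y
      by (simp add: B_def linear_simps[OF V(1)])
    then show ?thesis
      using X(4)[OF V(1)] by (simp add: S_def linear_simps[OF V(1)])
  qed
  have A1S: "A1 (S x) = S (A1 x)" for x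
    by (rule S_comm[OF lin1]) (simp add: A1_def linear_simps[OF linA])
  define P where "P = (\<lambda>x. S x - A1 x)"
  define Q where "Q = (\<lambda>x. S x + A1 x)"
  have PQ: "P (Q x) = 0" for x
    by (simp add: P_def Q_def linear_simps[OF linS] linear_simps[OF lin1] SS A1S)
  have linP: "bounded_linear P"
    unfolding P_def by (intro bounded_linear_sub linS lin1)
  have "commutant_member \<U> P"
    unfolding commutant_member_def
  proof (intro conjI allI ballI linP)
    fix a x
    have "S (a *\<^sub>C x) = a *\<^sub>C S x" "A1 (a *\<^sub>C x) = a *\<^sub>C A1 x"
      using A S_comm[OF bounded_linear_scaleC[of a], symmetric]
      by (auto simp: commutant_member_def A1_def scaleR_scaleC scaleC_scaleC mult.commute)
    then show "P (a *\<^sub>C x) = a *\<^sub>C P x"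
      by (simp add: P_def scaleC_diff_right)
  next
    fix U x
    assume "U \<in> \<U>"
    then have U: "bounded_linear U" "\<And>x. U (A x) = A (U x)"
      using A irred by (auto simp: commutant_member_def irreducible_family_def)
    then show "P (U x) = U (P x)"
      using S_comm[OF U] by (auto simp: P_def A1_def linear_simps[OF U(1)])
  qed
  then have "(\<forall>x. P x = 0) \<or> (\<forall>x. Q x = 0)"
    using commutant_member_kernel[of \<U> P] irred PQ by blast
  then have "(\<forall>x. A x = K *\<^sub>R S x) \<or> (\<forall>x. A x = - (K *\<^sub>R S x))"
  proof
    have A: "A x = K *\<^sub>R A1 x" for x
      using K(1) by (simp add: A1_def)
    show ?thesis if "\<forall>x. P x = 0"
      using that unfolding A by (simp add: P_def)
    show ?thesis if "\<forall>x. Q x = 0"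
      using that unfolding A by (metis Q_def add_eq_0_iff scaleR_minus_right)
  qed
  then show ?thesis
    using S_pos K(1) by (auto simp: rinner_def cinner_minus_left cinner_scaleR_left)
qed

text \<open>
  Subtract from \<open>A\<close> its Rayleigh quotient \<open>c\<close> at some \<open>z \<noteq> 0\<close>. The form of \<open>A - c\<close> is semidefinite and
  vanishes at \<open>z\<close>, so \<open>z\<close> is an extremal point of it and \<open>(A - c) z = 0\<close>. A nonzero kernel is
  everything.
\<close>

lemma commutant_selfadjoint_scalar:
  fixes A :: "'h::chilbert_space \<Rightarrow> 'h"
  assumes irred: "irreducible_family \<U>" and A: "commutant_member \<U> A"
    and sa: "\<And>x y. rinner (A x) y = rinner x (A y)"
  shows "\<exists>c. \<forall>x. A x = c *\<^sub>R x"
proof (cases "\<exists>z :: 'h. z \<noteq> 0")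
  case True
  then obtain z :: 'h where "z \<noteq> 0" ..
  define c where "c = rinner (A z) z / (norm z)\<^sup>2"
  define B where "B = (\<lambda>x. A x - c *\<^sub>R x)"
  have B: "commutant_member \<U> B"
    unfolding commutant_member_def
  proof (intro conjI allI ballI)
    show "bounded_linear B"
      using A unfolding B_def commutant_member_def
      by (intro bounded_linear_sub bounded_linear_const_scaleR bounded_linear_ident) auto
    show "B (a *\<^sub>C x) = a *\<^sub>C B x" for a x
      using A by (simp add: B_def commutant_member_def scaleC_diff_right scaleR_scaleC scaleC_scaleC mult.commute)
  next
    fix U x
    assume "U \<in> \<U>"
    then have U: "bounded_linear U" "A (U x) = U (A x)"
      using A irred by (auto simp: commutant_member_def irreducible_family_def)
    then show "B (U x) = U (B x)"
      by (auto simp: B_def linear_simps[OF U(1)])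
  qed
  then have linB: "bounded_linear B"
    by (simp add: commutant_member_def)
  have saB: "rinner (B x) y = rinner x (B y)" for x y
    by (simp add: B_def rinner_simps sa)
  have Bz: "rinner (B z) z = 0"
    using \<open>z \<noteq> 0\<close> by (simp add: B_def c_def rinner_simps rinner_self)
  have expand: "rinner (B (z + t *\<^sub>R v)) (z + t *\<^sub>R v) = 2 * t * rinner (B z) v + t\<^sup>2 * rinner (B v) v" for t v
  proof -
    have "rinner (B v) z = rinner (B z) v"
      by (metis saB rinner_commute)
    then show ?thesis
      by (simp add: linear_simps[OF linB] rinner_simps Bz power2_eq_square algebra_simps)
  qed
  have "rinner (B z) v = 0" for v
  proof -
    from commutant_member_semidefinite[OF irred B saB]
    have "2 * rinner (B z) v = 0"
    proof
      assume *: "\<forall>x. 0 \<le> rinner (B x) x"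
      show ?thesis
      proof (rule zero_if_linear_le_quadratic)
        show "t * (2 * rinner (B z) v) \<le> t\<^sup>2 * rinner (B v) v" for t
          using *[rule_format, of "z + (- t) *\<^sub>R v"] unfolding expand by (simp add: mult_ac)
      qed
    next
      assume *: "\<forall>x. rinner (B x) x \<le> 0"
      show ?thesis
      proof (rule zero_if_linear_le_quadratic)
        show "t * (2 * rinner (B z) v) \<le> t\<^sup>2 * (- rinner (B v) v)" for t
          using *[rule_format, of "z + t *\<^sub>R v"] unfolding expand by (simp add: mult_ac)
      qed
    qed
    then show ?thesis
      by simp
  qed
  then have "rinner (B z) (B z) = 0" .
  then have "B z = 0"
    by (simp add: rinner_self)
  then have "B x = 0" for x
    using commutant_member_kernel[OF irred B] \<open>z \<noteq> 0\<close> by blast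
  then show ?thesis
    by (auto simp: B_def)
next
  case False
  then show ?thesis
    by (metis (full_types))
qed

section \<open>Schur's lemma for closed quadratic forms\<close>

text \<open>
  A quadratic form with domain \<open>D\<close>. Closedness of all sublevel sets is lower semicontinuity of the
  extension of \<open>q\<close> by \<open>\<infinity>\<close> outside of \<open>D\<close>. The parallelogram law stands in for a bilinear form.
\<close>

locale closed_quadratic_form =
  fixes D :: "'h::chilbert_space set" and q :: "'h \<Rightarrow> real"
  assumes zero_dom: "0 \<in> D"
    and add_dom: "x \<in> D \<Longrightarrow> y \<in> D \<Longrightarrow> x + y \<in> D"
    and scaleC_dom: "x \<in> D \<Longrightarrow> a *\<^sub>C x \<in> D"
    and nonneg: "0 \<le> q x"
    and scaleC: "x \<in> D \<Longrightarrow> q (a *\<^sub>C x) = (cmod a)\<^sup>2 * q x"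
    and parallelogram: "x \<in> D \<Longrightarrow> y \<in> D \<Longrightarrow> q (x + y) + q (x - y) = 2 * q x + 2 * q y"
    and closed_sublevel: "closed {x \<in> D. q x \<le> M}"
begin

lemma scaleR_dom: "x \<in> D \<Longrightarrow> r *\<^sub>R x \<in> D"
  by (simp add: scaleR_scaleC scaleC_dom)

lemma scaleR: "x \<in> D \<Longrightarrow> q (r *\<^sub>R x) = r\<^sup>2 * q x"
  by (simp add: scaleR_scaleC scaleC)

lemma diff_dom: "x \<in> D \<Longrightarrow> y \<in> D \<Longrightarrow> x - y \<in> D"
  using add_dom[OF _ scaleR_dom[of y "-1"], of x] by simp

definition objective :: "'h \<Rightarrow> 'h \<Rightarrow> real" where
  "objective y x = (norm (x - y))\<^sup>2 + q x"

definition is_prox :: "'h \<Rightarrow> 'h \<Rightarrow> bool" where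
  "is_prox y x \<longleftrightarrow> x \<in> D \<and> (\<forall>v\<in>D. objective y x \<le> objective y v)"

lemma objective_parallelogram:
  assumes "x \<in> D" "x' \<in> D"
  shows "objective y x + objective y' x' =
    2 * objective ((1/2) *\<^sub>R (y + y')) ((1/2) *\<^sub>R (x + x')) +
    2 * objective ((1/2) *\<^sub>R (y - y')) ((1/2) *\<^sub>R (x - x'))"
proof -
  have "2 * q ((1/2) *\<^sub>R (x + x')) + 2 * q ((1/2) *\<^sub>R (x - x')) = q x + q x'"
    using parallelogram[OF assms] assms by (simp add: scaleR add_dom diff_dom power2_eq_square)
  moreover have "2 * (norm ((1/2) *\<^sub>R (a + b)))\<^sup>2 + 2 * (norm ((1/2) *\<^sub>R (a - b)))\<^sup>2
      = (norm a)\<^sup>2 + (norm b)\<^sup>2" for a b :: 'h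
    using norm_parallelogram[of a b] by (simp add: power2_eq_square)
  from this[of "x - y" "x' - y'"]
  have "2 * (norm ((1/2) *\<^sub>R (x + x') - (1/2) *\<^sub>R (y + y')))\<^sup>2 +
      2 * (norm ((1/2) *\<^sub>R (x - x') - (1/2) *\<^sub>R (y - y')))\<^sup>2 = (norm (x - y))\<^sup>2 + (norm (x' - y'))\<^sup>2"
    by (simp add: algebra_simps)
  ultimately show ?thesis
    by (simp only: objective_def) argo
qed

text \<open>
  The objective at the midpoint of \<open>x\<close> and \<open>x'\<close> falls below the mean of its values by at least a
  multiple of \<open>\<parallel>x - x'\<parallel>\<^sup>2\<close>. This gives the uniqueness of minimisers and the convergence of minimising
  sequences.
\<close>

lemma objective_gap:
  assumes "x \<in> D" "x' \<in> D" and lower: "\<And>v. v \<in> D \<Longrightarrow> m \<le> objective y v"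
  shows "(norm (x - x'))\<^sup>2 \<le> 2 * (objective y x - m) + 2 * (objective y x' - m)"
proof -
  have "m \<le> objective y ((1/2) *\<^sub>R (x + x'))"
    by (intro lower scaleR_dom add_dom assms)
  moreover have "(norm (x - x'))\<^sup>2 / 4 \<le> objective 0 ((1/2) *\<^sub>R (x - x'))"
    using nonneg[of "(1/2) *\<^sub>R (x - x')"] by (simp add: objective_def power2_eq_square)
  ultimately show ?thesis
    using objective_parallelogram[OF assms(1,2), of y y] by (simp flip: scaleR_2)
qed

lemma is_prox_unique: "is_prox y x \<Longrightarrow> is_prox y x' \<Longrightarrow> x = x'"
proof -
  assume x: "is_prox y x" and x': "is_prox y x'"
  then have "(norm (x - x'))\<^sup>2 \<le> 2 * (objective y x' - objective y x)"
    using objective_gap[of x x' "objective y x" y] by (simp add: is_prox_def)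
  also have "\<dots> \<le> 0"
    using x x' by (simp add: is_prox_def)
  finally show ?thesis
    by simp
qed

lemma is_prox_exists: "\<exists>x. is_prox y x"
proof -
  define m where "m = (INF x\<in>D. objective y x)"
  have bdd: "bdd_below (objective y ` D)"
    by (rule bdd_belowI[of _ 0]) (auto simp: objective_def nonneg)
  have lower: "m \<le> objective y v" if "v \<in> D" for v
    unfolding m_def using bdd that by (rule cINF_lower)
  have "\<exists>x\<in>D. objective y x < m + 1 / Suc n" for n
    using cINF_less_iff[of D "objective y" "m + 1 / Suc n"] bdd zero_dom by (auto simp: m_def)
  then obtain x where x: "\<And>n. x n \<in> D" "\<And>n. objective y (x n) < m + 1 / Suc n"
    by metis
  have "Cauchy x"
    unfolding Cauchy_altdef2
  proof (intro allI impI)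
    fix e :: real
    assume "e > 0"
    then obtain N :: nat where N: "1 / Suc N < e\<^sup>2 / 4"
      using nat_approx_posE[of "e\<^sup>2 / 4"] by auto
    have near: "objective y (x n) - m < e\<^sup>2 / 4" if "n \<ge> N" for n
    proof -
      have "1 / real (Suc n) \<le> 1 / Suc N"
        using that by (simp add: frac_le)
      with N have "1 / real (Suc n) < e\<^sup>2 / 4"
        by (rule le_less_trans[rotated])
      then show ?thesis
        using x(2)[of n] by argo
    qed
    have "dist (x n) (x N) < e" if "n \<ge> N" for n
    proof -
      have "(norm (x n - x N))\<^sup>2 \<le> 2 * (objective y (x n) - m) + 2 * (objective y (x N) - m)"
        by (rule objective_gap[OF x(1) x(1)]) (rule lower)
      then have "(norm (x n - x N))\<^sup>2 < e\<^sup>2"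
        using near[OF that] near[of N] by simp
      then show ?thesis
        using \<open>e > 0\<close> by (simp add: dist_norm power_less_imp_less_base)
    qed
    then show "\<exists>N. \<forall>n\<ge>N. dist (x n) (x N) < e"
      by blast
  qed
  then obtain z where z: "x \<longlonglongrightarrow> z"
    using Cauchy_convergent convergent_def by blast
  \<comment> \<open>The level exceeds the limit of the upper bounds for \<open>q (x n)\<close> by \<open>e\<close>, so \<open>q\<close> is eventually
    below it along the sequence; closedness of the sublevel set passes the bound to the limit.\<close>
  have sublevel: "z \<in> D \<and> q z \<le> m - (norm (z - y))\<^sup>2 + e" if "e > 0" for e
  proof -
    let ?M = "m - (norm (z - y))\<^sup>2 + e"
    have "(\<lambda>n. m + 1 / Suc n - (norm (x n - y))\<^sup>2) \<longlonglongrightarrow> m + 0 - (norm (z - y))\<^sup>2"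
      by (intro tendsto_intros z LIMSEQ_Suc[OF lim_1_over_n])
    then have "\<forall>\<^sub>F n in sequentially. m + 1 / Suc n - (norm (x n - y))\<^sup>2 < ?M"
      using that by (intro order_tendstoD(2)) auto
    then have "\<forall>\<^sub>F n in sequentially. x n \<in> {x \<in> D. q x \<le> ?M}"
    proof eventually_elim
      case (elim n)
      then show ?case
        using x(1)[of n] x(2)[of n] by (simp add: objective_def)
    qed
    then have "z \<in> {x \<in> D. q x \<le> ?M}"
      by (intro Lim_in_closed_set[OF closed_sublevel _ _ z]) auto
    then show ?thesis
      by simp
  qed
  have "objective y z \<le> m"
  proof (rule field_le_epsilon)
    show "objective y z \<le> m + e" if "e > 0" for e
      using sublevel[OF that] by (simp add: objective_def)
  qed
  then have "is_prox y z"
    using sublevel[of 1] lower unfolding is_prox_def by (auto intro: order_trans)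
  then show ?thesis ..
qed

definition prox :: "'h \<Rightarrow> 'h" where
  "prox y = (THE x. is_prox y x)"

lemma is_prox_prox: "is_prox y (prox y)"
  unfolding prox_def by (rule theI') (use is_prox_exists is_prox_unique in blast)

lemma prox_eqI: "is_prox y x \<Longrightarrow> prox y = x"
  using is_prox_unique is_prox_prox by blast

lemma prox_dom: "prox y \<in> D"
  using is_prox_prox by (simp add: is_prox_def)

lemma prox_le: "v \<in> D \<Longrightarrow> objective y (prox y) \<le> objective y v"
  using is_prox_prox by (simp add: is_prox_def)

text \<open>
  The scale factor \<open>k\<close> lets this cover both the unitary operators and the multiplications by
  nonzero complex scalars.
\<close>

lemma prox_equivariant:
  assumes V: "surj V" "\<And>x y. V (x - y) = V x - V y" "\<And>x. norm (V x) = k * norm x"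
    "\<And>x. V x \<in> D \<longleftrightarrow> x \<in> D" "\<And>x. x \<in> D \<Longrightarrow> q (V x) = k\<^sup>2 * q x"
  shows "prox (V y) = V (prox y)"
proof (rule prox_eqI)
  have obj: "objective (V y) (V x) = k\<^sup>2 * objective y x" if "x \<in> D" for x
    using that by (simp add: objective_def V(5) V(3) power_mult_distrib distrib_left flip: V(2))
  show "is_prox (V y) (V (prox y))"
    unfolding is_prox_def
  proof (intro conjI ballI)
    fix v
    assume "v \<in> D"
    then obtain u where "v = V u" "u \<in> D"
      using V(1,4) by (metis surjD)
    then show "objective (V y) (V (prox y)) \<le> objective (V y) v"
      by (simp add: obj prox_dom prox_le mult_left_mono)
  qed (simp add: V(4) prox_dom)
qed

lemma prox_scaleC: "prox (a *\<^sub>C y) = a *\<^sub>C prox y"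
proof (cases "a = 0")
  case True
  have "is_prox 0 0"
    using scaleR[OF zero_dom, of 0] nonneg by (auto simp: is_prox_def zero_dom objective_def)
  then show ?thesis
    using True by (simp add: prox_eqI)
next
  case False
  have inv: "(1 / a) *\<^sub>C a *\<^sub>C x = x" "a *\<^sub>C (1 / a) *\<^sub>C x = x" for x :: 'h
    using False by (simp_all add: scaleC_scaleC) (metis of_real_1 scaleR_one scaleR_scaleC)+
  show ?thesis
  proof (rule prox_equivariant)
    show "surj (\<lambda>x :: 'h. a *\<^sub>C x)"
      by (rule surjI[where f = "\<lambda>x :: 'h. (1 / a) *\<^sub>C x"]) (rule inv(2))
    show "a *\<^sub>C x \<in> D \<longleftrightarrow> x \<in> D" for x
      using inv(1) scaleC_dom by metis
  qed (auto simp: scaleC_diff_right norm_scaleC scaleC)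
qed

lemma prox_scaleR: "prox (r *\<^sub>R y) = r *\<^sub>R prox y"
  by (simp add: scaleR_scaleC prox_scaleC)

text \<open>
  It suffices that \<open>prox\<close> preserves midpoints. Move both minimisers \<open>prox y\<close>, \<open>prox y'\<close> by the same
  vector \<open>w\<close>. By the parallelogram law the sum of the two objectives is twice the objective of the
  midpoint plus a part that depends on differences only, which \<open>w\<close> does not change. So moving the
  midpoint by \<open>w\<close> cannot lower its objective.
\<close>

lemma prox_add: "prox (y + y') = prox y + prox y'"
proof -
  let ?x = "prox y" and ?x' = "prox y'"
  let ?y = "(1/2) *\<^sub>R (y + y')" and ?m = "(1/2) *\<^sub>R (?x + ?x')"
  have "prox ?y = ?m"
  proof (rule prox_eqI, unfold is_prox_def, intro conjI ballI)
    show "?m \<in> D"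
      by (intro scaleR_dom add_dom prox_dom)
    fix v
    assume "v \<in> D"
    define w where "w = v - ?m"
    have w: "w \<in> D"
      unfolding w_def by (intro diff_dom \<open>v \<in> D\<close> \<open>?m \<in> D\<close>)
    have "(1/2) *\<^sub>R ((?x + w) + (?x' + w)) = v"
    proof -
      have "(1/2) *\<^sub>R ((?x + w) + (?x' + w)) = ?m + (1/2) *\<^sub>R (w + w)"
        by (simp only: scaleR_add_right ac_simps)
      then show ?thesis
        by (simp add: w_def flip: scaleR_2)
    qed
    then have "objective y (?x + w) + objective y' (?x' + w) =
        2 * objective ?y v + 2 * objective ((1/2) *\<^sub>R (y - y')) ((1/2) *\<^sub>R (?x - ?x'))"
      using objective_parallelogram[of "?x + w" "?x' + w" y y'] by (simp add: add_dom prox_dom w)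
    moreover have "objective y ?x + objective y' ?x' =
        2 * objective ?y ?m + 2 * objective ((1/2) *\<^sub>R (y - y')) ((1/2) *\<^sub>R (?x - ?x'))"
      by (intro objective_parallelogram prox_dom)
    ultimately show "objective ?y ?m \<le> objective ?y v"
      using prox_le[of "?x + w" y] prox_le[of "?x' + w" y'] by (simp add: add_dom prox_dom w)
  qed
  then show ?thesis
    by (simp only: prox_scaleR) simp
qed

lemma prox_objective_expand:
  "objective y (t *\<^sub>R prox y) = (norm y)\<^sup>2 - 2 * t * rinner (prox y) y + t\<^sup>2 * ((norm (prox y))\<^sup>2 + q (prox y))"
  by (simp add: objective_def norm_diff_sq scaleR prox_dom rinner_simps power_mult_distrib algebra_simps)

text \<open>
  The objective is stationary at its minimiser along the ray through it.
\<close>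

lemma rinner_prox: "rinner (prox y) y = (norm (prox y))\<^sup>2 + q (prox y)"
proof -
  let ?b = "(norm (prox y))\<^sup>2 + q (prox y)" and ?r = "rinner (prox y) y"
  have "2 * (?r - ?b) = 0"
  proof (rule zero_if_linear_le_quadratic)
    fix t :: real
    have "objective y (1 *\<^sub>R prox y) \<le> objective y ((1 + t) *\<^sub>R prox y)"
      by (simp add: prox_le scaleR_dom prox_dom)
    then show "t * (2 * (?r - ?b)) \<le> t\<^sup>2 * ?b"
      unfolding prox_objective_expand by (simp add: algebra_simps power2_eq_square)
  qed
  then show ?thesis
    by simp
qed

lemma objective_prox: "objective y (prox y) = (norm y)\<^sup>2 - rinner (prox y) y"
  using prox_objective_expand[of y 1] rinner_prox[of y] by simp

lemma norm_prox: "norm (prox y) \<le> norm y"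
proof (cases "prox y = 0")
  case False
  have "norm (prox y) * norm (prox y) \<le> norm (prox y) * norm y"
    using rinner_prox[of y] rinner_le_norm[of "prox y" y] nonneg[of "prox y"]
    by (simp add: power2_eq_square)
  then show ?thesis
    using False by simp
qed simp

lemma bounded_linear_prox: "bounded_linear prox"
  by (rule bounded_linear_intro[of _ 1]) (auto simp: prox_add prox_scaleR norm_prox)

text \<open>
  The minimal value at \<open>y\<close> is \<open>\<parallel>y\<parallel>\<^sup>2 - \<langle>prox y, y\<rangle>\<close>. At \<open>x + t y\<close> it is at most the objective at the old
  minimiser \<open>prox x\<close>, with equality for \<open>t = 0\<close>. Comparing the terms of first order in \<open>t\<close> gives
  symmetry.
\<close>

lemma prox_selfadjoint: "rinner (prox x) y = rinner x (prox y)"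
proof -
  have "rinner y (prox x) - rinner x (prox y) = 0"
  proof (rule zero_if_linear_le_quadratic)
    fix t :: real
    have "objective (x + t *\<^sub>R y) (prox (x + t *\<^sub>R y)) \<le> objective (x + t *\<^sub>R y) (prox x)"
      by (simp add: prox_le prox_dom)
    moreover have "objective (x + t *\<^sub>R y) (prox x) =
        objective x (prox x) - 2 * t * rinner (prox x - x) y + t\<^sup>2 * (norm y)\<^sup>2"
      unfolding objective_def using norm_diff_sq[of "prox x - x" "t *\<^sub>R y"]
      by (simp add: diff_diff_eq rinner_simps power_mult_distrib)
    moreover have "objective (x + t *\<^sub>R y) (prox (x + t *\<^sub>R y)) =
        (norm x)\<^sup>2 + 2 * t * rinner x y + t\<^sup>2 * (norm y)\<^sup>2 -
        (rinner (prox x) x + t * rinner (prox x) y + t * rinner (prox y) x + t\<^sup>2 * rinner (prox y) y)"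
      unfolding objective_prox rinner_self[symmetric]
      by (simp add: prox_add prox_scaleR rinner_simps rinner_commute[of y x] algebra_simps power2_eq_square)
    ultimately show "t * (rinner y (prox x) - rinner x (prox y)) \<le> t\<^sup>2 * rinner (prox y) y"
      unfolding objective_prox
      by (simp add: rinner_simps algebra_simps rinner_commute[of y "prox x"] rinner_commute[of x "prox y"])
  qed
  then show ?thesis
    by (simp add: rinner_commute)
qed

text \<open>
  Uniqueness of the minimiser makes \<open>prox\<close> commute with the family, so \<open>prox\<close> is a scalar \<open>c\<close>. A nonzero
  vector in the domain excludes \<open>c = 0\<close>. Then \<open>prox\<close> is onto, hence \<open>D\<close> is the whole space, and
  \<open>rinner_prox\<close> can be solved for \<open>q\<close>.
\<close>

theorem invariant_form_scalar:
  assumes irred: "irreducible_family \<U>"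
    and unitary: "\<And>U. U \<in> \<U> \<Longrightarrow> unitary_operator U"
    and inv_dom: "\<And>U x. U \<in> \<U> \<Longrightarrow> U x \<in> D \<longleftrightarrow> x \<in> D"
    and inv: "\<And>U x. U \<in> \<U> \<Longrightarrow> x \<in> D \<Longrightarrow> q (U x) = q x"
    and z: "z \<in> D" "z \<noteq> 0"
  shows "D = UNIV \<and> (\<exists>c. \<forall>x. q x = c * (norm x)\<^sup>2)"
proof -
  have "commutant_member \<U> prox"
    unfolding commutant_member_def
  proof (intro conjI ballI allI bounded_linear_prox prox_scaleC)
    fix U x
    assume "U \<in> \<U>"
    note U = unitary[OF this]
    show "prox (U x) = U (prox x)"
      by (rule prox_equivariant[of U 1])
        (simp_all add: unitary_operator_surj[OF U] unitary_operator_diff[OF U]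
          unitary_operator_norm[OF U] inv_dom[OF \<open>U \<in> \<U>\<close>] inv[OF \<open>U \<in> \<U>\<close>])
  qed
  then obtain c where c: "\<And>x. prox x = c *\<^sub>R x"
    using commutant_selfadjoint_scalar[OF irred _ prox_selfadjoint] by blast
  have "c \<noteq> 0"
  proof
    assume "c = 0"
    \<comment> \<open>If \<open>0\<close> minimised the objective for \<open>z\<close>, then moving towards \<open>z\<close> could not lower it.\<close>
    have "2 * (norm z)\<^sup>2 = 0"
    proof (rule zero_if_linear_le_quadratic)
      fix t :: real
      have "objective z (prox z) \<le> objective z (t *\<^sub>R z)"
        by (intro prox_le scaleR_dom z)
      then show "t * (2 * (norm z)\<^sup>2) \<le> t\<^sup>2 * ((norm z)\<^sup>2 + q z)"
        using scaleR[OF zero_dom, of 0] unfolding objective_prox c \<open>c = 0\<close>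
        by (simp add: objective_def norm_diff_sq rinner_simps rinner_self scaleR z power_mult_distrib
            algebra_simps)
    qed
    then show False
      using z(2) by simp
  qed
  have dom: "x \<in> D" for x
    using scaleR_dom[OF prox_dom, of "1 / c" x] \<open>c \<noteq> 0\<close> by (simp add: c)
  moreover have "q x = ((1 - c) / c) * (norm x)\<^sup>2" for x
  proof -
    have "c * (norm x)\<^sup>2 = c\<^sup>2 * ((norm x)\<^sup>2 + q x)"
      using rinner_prox[of x]
      by (simp add: c rinner_simps rinner_self scaleR dom power_mult_distrib distrib_left)
    then have "(norm x)\<^sup>2 = c * ((norm x)\<^sup>2 + q x)"
      using \<open>c \<noteq> 0\<close> by (simp add: power2_eq_square)
    then show ?thesis
      using \<open>c \<noteq> 0\<close> by (simp add: field_simps)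
  qed
  ultimately show ?thesis
    by blast
qed

end

section \<open>Translations of a homogeneous space\<close>

locale coset_space = topological_group +
  fixes H
  assumes H: "subgroup H G"
begin

abbreviation X :: "'a set topology" where
  "X \<equiv> coset_topology G T H"

definition translate :: "'a \<Rightarrow> 'a set set \<Rightarrow> 'a set set" where
  "translate s A = (\<lambda>C. s <# C) ` A"

lemma H_carrier: "H \<subseteq> carrier G"
  using H by (rule subgroup.subset)

lemma coset_in: "g \<in> carrier G \<Longrightarrow> g <# H \<in> lcosets H"
  by (auto simp: LCOSETS_def)

lemma cosetE:
  assumes "C \<in> lcosets H"
  obtains g where "g \<in> carrier G" "C = g <# H"
  using assms by (auto simp: LCOSETS_def)

lemma act_coset: "s \<in> carrier G \<Longrightarrow> g \<in> carrier G \<Longrightarrow> s <# (g <# H) = (s \<otimes> g) <# H"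
  by (rule lcos_m_assoc[OF H_carrier])

lemma act_in: "s \<in> carrier G \<Longrightarrow> C \<in> lcosets H \<Longrightarrow> s <# C \<in> lcosets H"
  by (auto elim!: cosetE simp: act_coset coset_in)

lemma act_act: "s \<in> carrier G \<Longrightarrow> t \<in> carrier G \<Longrightarrow> C \<in> lcosets H \<Longrightarrow> s <# (t <# C) = (s \<otimes> t) <# C"
  by (auto elim!: cosetE simp: act_coset m_assoc)

lemma act_one: "C \<in> lcosets H \<Longrightarrow> \<one> <# C = C"
  by (auto elim!: cosetE simp: act_coset)

lemma coset_eq_iff:
  assumes "g \<in> carrier G" "u \<in> carrier G"
  shows "g <# H = u <# H \<longleftrightarrow> (\<exists>h\<in>H. g \<otimes> h = u)"
proof
  assume "g <# H = u <# H"
  then have "u \<in> g <# H"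
    using lcos_self[OF assms(2) H] by simp
  then show "\<exists>h\<in>H. g \<otimes> h = u"
    by (auto simp: l_coset_def)
next
  assume "\<exists>h\<in>H. g \<otimes> h = u"
  then obtain h where h: "h \<in> H" "g \<otimes> h = u" ..
  then have "h <# H = H"
    using H H_carrier by (intro coset_join3) auto
  then show "g <# H = u <# H"
    using h H_carrier assms(1) act_coset[of g h] by auto
qed

lemma translate_subset: "s \<in> carrier G \<Longrightarrow> A \<subseteq> lcosets H \<Longrightarrow> translate s A \<subseteq> lcosets H"
  by (auto simp: translate_def act_in)

lemma mem_translate:
  assumes "s \<in> carrier G" "A \<subseteq> lcosets H"
  shows "C \<in> translate s A \<longleftrightarrow> C \<in> lcosets H \<and> inv s <# C \<in> A"
proof
  assume "C \<in> translate s A"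
  then show "C \<in> lcosets H \<and> inv s <# C \<in> A"
    using assms by (auto simp: translate_def act_in act_act act_one subset_iff)
next
  assume C: "C \<in> lcosets H \<and> inv s <# C \<in> A"
  then have "C = s <# (inv s <# C)"
    using assms by (simp add: act_act act_one)
  then show "C \<in> translate s A"
    using C unfolding translate_def by blast
qed

lemma translate_translate:
  "s \<in> carrier G \<Longrightarrow> t \<in> carrier G \<Longrightarrow> A \<subseteq> lcosets H \<Longrightarrow>
    translate s (translate t A) = translate (s \<otimes> t) A"
  unfolding translate_def image_image by (intro image_cong) (auto simp: act_act subset_iff)

lemma translate_one: "A \<subseteq> lcosets H \<Longrightarrow> translate \<one> A = A"
  unfolding translate_def by (auto simp: act_one subset_iff image_iff)

lemma translate_diff:
  assumes "s \<in> carrier G" "A \<subseteq> lcosets H" "B \<subseteq> lcosets H"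
  shows "translate s (A - B) = translate s A - translate s B"
  using assms by (auto simp: mem_translate set_eq_iff Diff_subset[THEN subset_trans])

lemma translate_mono: "A \<subseteq> B \<Longrightarrow> translate s A \<subseteq> translate s B"
  by (auto simp: translate_def)

lemma continuous_mult:
  assumes "continuous_map Z T f" "continuous_map Z T g"
  shows "continuous_map Z T (\<lambda>x. f x \<otimes> g x)"
  using continuous_map_compose[OF continuous_map_pairedI[OF assms] continuous_map_mult]
  by (simp add: o_def)

lemma continuous_inv: "continuous_map Z T f \<Longrightarrow> continuous_map Z T (\<lambda>x. inv f x)"
  using continuous_map_compose[OF _ continuous_map_inv] by (simp add: o_def)

lemma continuous_const: "s \<in> carrier G \<Longrightarrow> continuous_map Z T (\<lambda>x. s)"
  by (simp add: topspace_eq_carrier)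

lemma continuous_ident: "continuous_map T T (\<lambda>x. x)"
  using continuous_map_id by (simp add: id_def)

lemma open_carrier: "openin T U \<Longrightarrow> U \<subseteq> carrier G"
  using openin_subset topspace_eq_carrier by metis

lemma openin_vimage:
  assumes "continuous_map T T f" "openin T U"
  shows "openin T {g \<in> carrier G. f g \<in> U}"
  using openin_continuous_map_preimage[OF assms] by (simp add: topspace_eq_carrier)

lemma open_subset_cosets: "openin X U \<Longrightarrow> U \<subseteq> lcosets H"
  by (simp add: openin_coset_topology)

lemma open_preimage: "openin X U \<Longrightarrow> openin T {g \<in> carrier G. g <# H \<in> U}"
  by (simp add: openin_coset_topology)

lemma openin_translate:
  assumes s: "s \<in> carrier G" and U: "openin X U"
  shows "openin X (translate s U)"
  unfolding openin_coset_topology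
proof
  note U' = open_subset_cosets[OF U]
  show "translate s U \<subseteq> lcosets H"
    by (rule translate_subset[OF s U'])
  have "{g \<in> carrier G. g <# H \<in> translate s U} =
      {g \<in> carrier G. inv s \<otimes> g \<in> {g \<in> carrier G. g <# H \<in> U}}"
    using s by (auto simp: mem_translate[OF s U'] coset_in act_coset)
  also have "openin T \<dots>"
    using s by (intro openin_vimage continuous_mult continuous_const continuous_ident open_preimage U) simp
  finally show "openin T {g \<in> carrier G. g <# H \<in> translate s U}" .
qed

text \<open>
  The quotient map is open: the saturation of \<open>U\<close> is a union of right translates of \<open>U\<close>.
\<close>

lemma openin_coset_image:
  assumes U: "openin T U"
  shows "openin X ((\<lambda>g. g <# H) ` U)"
  unfolding openin_coset_topology
proof
  show "(\<lambda>g. g <# H) ` U \<subseteq> lcosets H"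
    using open_carrier[OF U] by (auto simp: coset_in)
  have "g <# H \<in> (\<lambda>g. g <# H) ` U \<longleftrightarrow> (\<exists>h\<in>H. g \<otimes> h \<in> U)" if "g \<in> carrier G" for g
    using open_carrier[OF U] that coset_eq_iff by (auto simp: image_iff subset_iff)
  then have "{g \<in> carrier G. g <# H \<in> (\<lambda>g. g <# H) ` U} = (\<Union>h\<in>H. {g \<in> carrier G. g \<otimes> h \<in> U})"
    by blast
  also have "openin T \<dots>"
    using H_carrier by (intro openin_Union) (auto intro!: openin_vimage continuous_mult continuous_const continuous_ident U)
  finally show "openin T {g \<in> carrier G. g <# H \<in> (\<lambda>g. g <# H) ` U}" .
qed

end

section \<open>Open sets of finite measure under translation\<close>

locale homogeneous_measure_space = coset_space +
  fixes \<mu>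
  assumes locally_compact: "locally_compact_space T"
    and compact_H: "compactin T H"
    and invariant: "invariant_radon_measure G T H \<mu>"
begin

lemma space_mu: "space \<mu> = lcosets H"
  using invariant by (simp add: invariant_radon_measure_def radon_measure_def topspace_coset_topology)

lemma sets_mu: "sets \<mu> = sigma_sets (lcosets H) {U. openin X U}"
  using invariant by (simp add: invariant_radon_measure_def radon_measure_def topspace_coset_topology)

lemma open_sets: "openin X U \<Longrightarrow> U \<in> sets \<mu>"
  by (simp add: sets_mu)

lemma emeasure_translate: "s \<in> carrier G \<Longrightarrow> A \<in> sets \<mu> \<Longrightarrow> emeasure \<mu> (translate s A) = emeasure \<mu> A"
  using invariant by (simp add: invariant_radon_measure_def translate_def)

lemma inner_regular: "openin X U \<Longrightarrow> emeasure \<mu> U = (SUP K\<in>{K. compactin X K \<and> K \<subseteq> U}. emeasure \<mu> K)"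
  using invariant unfolding invariant_radon_measure_def radon_measure_def by blast

lemma measurable_act:
  assumes s: "s \<in> carrier G"
  shows "(\<lambda>C. s <# C) \<in> measurable \<mu> \<mu>"
proof (rule measurable_sigma_sets[OF sets_mu])
  show "{U. openin X U} \<subseteq> Pow (lcosets H)"
    using open_subset_cosets by blast
  show "(\<lambda>C. s <# C) \<in> space \<mu> \<rightarrow> lcosets H"
    using s by (auto simp: space_mu act_in)
  fix U
  assume "U \<in> {U. openin X U}"
  then have U: "openin X U" "U \<subseteq> lcosets H"
    using open_subset_cosets by auto
  have "(\<lambda>C. s <# C) -` U \<inter> space \<mu> = translate (inv s) U"
    using s U by (auto simp: mem_translate space_mu)
  then show "(\<lambda>C. s <# C) -` U \<inter> space \<mu> \<in> sets \<mu>"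
    using s U by (simp add: open_sets openin_translate)
qed

lemma nn_integral_translate:
  assumes s: "s \<in> carrier G" and f: "f \<in> borel_measurable \<mu>"
  shows "(\<integral>\<^sup>+ C. f (s <# C) \<partial>\<mu>) = (\<integral>\<^sup>+ C. f C \<partial>\<mu>)"
proof -
  have "distr \<mu> \<mu> (\<lambda>C. s <# C) = \<mu>"
  proof (rule measure_eqI)
    fix A
    assume "A \<in> sets (distr \<mu> \<mu> (\<lambda>C. s <# C))"
    then have A: "A \<in> sets \<mu>"
      by simp
    then have sub: "A \<subseteq> lcosets H"
      using sets.sets_into_space space_mu by blast
    have "emeasure (distr \<mu> \<mu> (\<lambda>C. s <# C)) A = emeasure \<mu> ((\<lambda>C. s <# C) -` A \<inter> space \<mu>)"
      by (rule emeasure_distr[OF measurable_act[OF s] A])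
    also have "(\<lambda>C. s <# C) -` A \<inter> space \<mu> = translate (inv s) A"
      using s sub by (auto simp: mem_translate space_mu)
    also have "emeasure \<mu> \<dots> = emeasure \<mu> A"
      using s A by (simp add: emeasure_translate)
    finally show "emeasure (distr \<mu> \<mu> (\<lambda>C. s <# C)) A = emeasure \<mu> A" .
  qed simp
  then show ?thesis
    using nn_integral_distr[OF measurable_act[OF s], of f] f by simp
qed

text \<open>
  The group acts continuously on cosets, and local compactness of \<open>G\<close> allows the neighbourhood to
  be covered by the image of a compact subset of \<open>G\<close>.
\<close>

lemma local_shrinking:
  assumes E: "openin X E" and C: "C \<in> E"
  obtains N V Q where "openin X N" "C \<in> N" "openin T V" "\<one> \<in> V" "compactin T Q"
    "N \<subseteq> (\<lambda>g. g <# H) ` Q" "\<And>v D. v \<in> V \<Longrightarrow> D \<in> N \<Longrightarrow> v <# D \<in> E"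
proof -
  obtain k where k: "k \<in> carrier G" "C = k <# H"
    using C open_subset_cosets[OF E] by (auto elim: cosetE)
  define W where "W = {g \<in> carrier G. g <# H \<in> E}"
  have W: "openin T W"
    unfolding W_def by (rule open_preimage[OF E])
  define S where "S = {z \<in> topspace (prod_topology T T). (\<lambda>(x, y). x \<otimes> y) z \<in> W}"
  have "openin (prod_topology T T) S"
    unfolding S_def by (rule openin_continuous_map_preimage[OF continuous_map_mult W])
  moreover have "(\<one>, k) \<in> S"
    using k C by (simp add: S_def W_def topspace_eq_carrier)
  ultimately obtain V U where VU: "openin T V" "openin T U" "\<one> \<in> V" "k \<in> U" "V \<times> U \<subseteq> S"
    using openin_prod_topology_alt[of T T S] by blast
  obtain U' Q where U': "openin T U'" "compactin T Q" "k \<in> U'" "U' \<subseteq> Q"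
    using locally_compact k(1) by (auto simp: locally_compact_space_def topspace_eq_carrier)
  show ?thesis
  proof
    show "openin X ((\<lambda>g. g <# H) ` (U \<inter> U'))"
      by (intro openin_coset_image openin_Int VU U')
    show "C \<in> (\<lambda>g. g <# H) ` (U \<inter> U')"
      using k VU U' by auto
    show "(\<lambda>g. g <# H) ` (U \<inter> U') \<subseteq> (\<lambda>g. g <# H) ` Q"
      using U' by auto
    fix v D
    assume "v \<in> V" "D \<in> (\<lambda>g. g <# H) ` (U \<inter> U')"
    then obtain u where u: "u \<in> U" "D = u <# H"
      by auto
    then have "(v, u) \<in> S"
      using VU(5) \<open>v \<in> V\<close> by blast
    moreover have "v \<in> carrier G" "u \<in> carrier G"
      using u(1) \<open>v \<in> V\<close> open_carrier[OF VU(1)] open_carrier[OF VU(2)] by blast+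
    ultimately show "v <# D \<in> E"
      using u(2) by (simp add: S_def W_def act_coset)
  qed (use VU U' in auto)
qed

text \<open>
  Inner regularity gives a compact subset \<open>K\<close> of \<open>E\<close> of almost full measure, and finitely many of the
  local neighbourhoods cover it. Their union \<open>E'\<close> is open and hence measurable, and it inherits
  from them both the room to move inside of \<open>E\<close> and the cover by the image of a compact subset of \<open>G\<close>.
\<close>

lemma inner_shrinking:
  assumes E: "openin X E" "emeasure \<mu> E < \<infinity>" and \<epsilon>: "0 < (\<epsilon> :: ennreal)"
  obtains E' V Q where "openin X E'" "E' \<subseteq> E" "openin T V" "\<one> \<in> V" "compactin T Q"
    "E' \<subseteq> (\<lambda>g. g <# H) ` Q" "\<And>v D. v \<in> V \<Longrightarrow> D \<in> E' \<Longrightarrow> v <# D \<in> E"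
    "emeasure \<mu> (E - E') < \<epsilon>"
proof -
  obtain e :: real where e: "e > 0" "ennreal e \<le> \<epsilon>"
  proof (cases \<epsilon>)
    case (real r)
    then show ?thesis
      using \<epsilon> that[of r] by auto
  next
    case top
    then show ?thesis
      using that[of 1] by auto
  qed
  have "{K. compactin X K \<and> K \<subseteq> E} \<noteq> {}"
    using compactin_empty by blast
  then obtain K where K: "compactin X K" "K \<subseteq> E" "emeasure \<mu> E < emeasure \<mu> K + e"
    using SUP_approx_ennreal[OF e(1) _ inner_regular[OF E(1)]] E(2) by (auto simp: less_top)
  have "\<forall>C\<in>K. \<exists>N V Q. openin X N \<and> C \<in> N \<and> openin T V \<and> \<one> \<in> V \<and> compactin T Q \<and>
      N \<subseteq> (\<lambda>g. g <# H) ` Q \<and> (\<forall>v\<in>V. \<forall>D\<in>N. v <# D \<in> E)"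
  proof
    fix C
    assume "C \<in> K"
    then have "C \<in> E"
      using K(2) by auto
    obtain N V Q where "openin X N" "C \<in> N" "openin T V" "\<one> \<in> V" "compactin T Q"
      "N \<subseteq> (\<lambda>g. g <# H) ` Q" "\<And>v D. v \<in> V \<Longrightarrow> D \<in> N \<Longrightarrow> v <# D \<in> E"
      using local_shrinking[OF E(1) \<open>C \<in> E\<close>] by blast
    then show "\<exists>N V Q. openin X N \<and> C \<in> N \<and> openin T V \<and> \<one> \<in> V \<and> compactin T Q \<and>
        N \<subseteq> (\<lambda>g. g <# H) ` Q \<and> (\<forall>v\<in>V. \<forall>D\<in>N. v <# D \<in> E)"
      by blast
  qed
  then obtain N V Q where NVQ: "\<And>C. C \<in> K \<Longrightarrow> openin X (N C) \<and> C \<in> N C \<and> openin T (V C) \<and>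
      \<one> \<in> V C \<and> compactin T (Q C) \<and> N C \<subseteq> (\<lambda>g. g <# H) ` Q C \<and> (\<forall>v\<in>V C. \<forall>D\<in>N C. v <# D \<in> E)"
    by metis
  obtain \<F> where "finite \<F>" "\<F> \<subseteq> N ` K" "K \<subseteq> \<Union>\<F>"
    using compactinD[OF K(1), of "N ` K"] NVQ by blast
  then obtain F where F: "finite F" "F \<subseteq> K" "K \<subseteq> (\<Union>C\<in>F. N C)"
    by (metis finite_subset_image)
  define E' where "E' = (\<Union>C\<in>F. N C)"
  have sub: "E' \<subseteq> E"
  proof
    fix D
    assume "D \<in> E'"
    then obtain C where C: "C \<in> F" "D \<in> N C"
      by (auto simp: E'_def)
    with NVQ F(2) have "\<one> <# D \<in> E" "D \<in> lcosets H"
      using open_subset_cosets by blast+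
    then show "D \<in> E"
      by (simp add: act_one)
  qed
  have open': "openin X E'"
    unfolding E'_def using NVQ F(2) by (intro openin_Union) auto
  show ?thesis
  proof
    show "openin X E'" "E' \<subseteq> E"
      by fact+
    show "openin T (\<Inter> (insert (topspace T) (V ` F)))"
      using F NVQ by (intro openin_Inter) auto
    show "\<one> \<in> \<Inter> (insert (topspace T) (V ` F))"
      using F NVQ by (auto simp: topspace_eq_carrier)
    show "compactin T (\<Union>C\<in>F. Q C)"
      using F NVQ by (intro compactin_Union) auto
    show "E' \<subseteq> (\<lambda>g. g <# H) ` (\<Union>C\<in>F. Q C)"
      unfolding E'_def using F NVQ by fast
    show "v <# D \<in> E" if "v \<in> \<Inter> (insert (topspace T) (V ` F))" "D \<in> E'" for v D
      using that F NVQ unfolding E'_def by auto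
    have "emeasure \<mu> E < emeasure \<mu> E' + e"
      using K(3) F(3) emeasure_mono[OF _ open_sets[OF open'], of K] unfolding E'_def
      by (meson add_right_mono order_less_le_trans)
    also have "\<dots> \<le> emeasure \<mu> E' + \<epsilon>"
      using e(2) by (rule add_left_mono)
    also have "emeasure \<mu> E = emeasure \<mu> E' + emeasure \<mu> (E - E')"
      using plus_emeasure[of E' \<mu> "E - E'"] sub open_sets[OF E(1)] open_sets[OF open']
      by (auto simp: Un_absorb1)
    finally show "emeasure \<mu> (E - E') < \<epsilon>"
      by (simp add: ennreal_add_left_cancel_less)
  qed
qed

text \<open>
  A translation by an element of \<open>V\<close> keeps \<open>E'\<close> inside of \<open>E\<close>, so only the small rest \<open>E - E'\<close> can leave.
\<close>

lemma translate_continuous_at_one: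
  assumes E: "openin X E" "emeasure \<mu> E < \<infinity>" and \<epsilon>: "0 < (\<epsilon> :: ennreal)"
  obtains V where "openin T V" "\<one> \<in> V" "\<And>v. v \<in> V \<Longrightarrow> emeasure \<mu> (translate v E - E) < \<epsilon>"
proof -
  obtain E' V Q where V: "openin X E'" "E' \<subseteq> E" "openin T V" "\<one> \<in> V"
    "\<And>v D. v \<in> V \<Longrightarrow> D \<in> E' \<Longrightarrow> v <# D \<in> E" "emeasure \<mu> (E - E') < \<epsilon>"
    by (rule inner_shrinking[OF assms]) (rule that)
  have "emeasure \<mu> (translate v E - E) < \<epsilon>" if "v \<in> V" for v
  proof -
    have v: "v \<in> carrier G"
      using that open_carrier[OF V(3)] by auto
    have "translate v E - E \<subseteq> translate v (E - E')"
      using V(5)[OF that] unfolding translate_def by blast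
    moreover have "translate v (E - E') \<in> sets \<mu>"
      unfolding translate_diff[OF v open_subset_cosets[OF E(1)] open_subset_cosets[OF V(1)]]
      by (intro sets.Diff open_sets openin_translate v E(1) V(1))
    ultimately have "emeasure \<mu> (translate v E - E) \<le> emeasure \<mu> (translate v (E - E'))"
      by (rule emeasure_mono)
    also have "\<dots> = emeasure \<mu> (E - E')"
      using v V(1) E(1) by (intro emeasure_translate) (auto intro: open_sets)
    finally show ?thesis
      using V(6) by simp
  qed
  then show ?thesis
    by (rule that[OF V(3,4)])
qed

lemma translate_continuous:
  assumes E: "openin X E" "emeasure \<mu> E < \<infinity>" and \<epsilon>: "0 < (\<epsilon> :: ennreal)" and s: "s \<in> carrier G"
  obtains U where "openin T U" "s \<in> U"
    "\<And>t. t \<in> U \<Longrightarrow> emeasure \<mu> (translate t E - translate s E) < \<epsilon>"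
    "\<And>t. t \<in> U \<Longrightarrow> emeasure \<mu> (translate s E - translate t E) < \<epsilon>"
proof -
  obtain V where V: "openin T V" "\<one> \<in> V" "\<And>v. v \<in> V \<Longrightarrow> emeasure \<mu> (translate v E - E) < \<epsilon>"
    using translate_continuous_at_one[OF E \<epsilon>] by blast
  have *: "emeasure \<mu> (translate t E - translate u E) < \<epsilon>"
    if "t \<in> carrier G" "u \<in> carrier G" "inv u \<otimes> t \<in> V" for t u
  proof -
    have "translate t E - translate u E = translate u (translate (inv u \<otimes> t) E - E)"
      using that E(1)
      by (simp add: translate_diff translate_subset open_subset_cosets translate_translate m_assoc[symmetric])
    also have "emeasure \<mu> \<dots> = emeasure \<mu> (translate (inv u \<otimes> t) E - E)"
      using that E(1) by (intro emeasure_translate sets.Diff open_sets openin_translate) auto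
    finally show ?thesis
      using V(3)[OF that(3)] by simp
  qed
  show ?thesis
  proof
    let ?U = "{t \<in> carrier G. inv s \<otimes> t \<in> V} \<inter> {t \<in> carrier G. inv t \<otimes> s \<in> V}"
    show "openin T ?U"
      using s by (intro openin_Int openin_vimage continuous_mult continuous_inv continuous_const
          continuous_ident V(1)) auto
    show "s \<in> ?U"
      using s V(2) by simp
    show "emeasure \<mu> (translate t E - translate s E) < \<epsilon>"
      "emeasure \<mu> (translate s E - translate t E) < \<epsilon>" if "t \<in> ?U" for t
      using that s by (auto intro: *)
  qed
qed

text \<open>
  The translates \<open>s E\<close> and \<open>t E\<close> can meet only if \<open>s\<close> lies in \<open>t L\<close> for the compact set \<open>L = Q H Q\<^sup>-\<^sup>1\<close>.
  Finitely many sets \<open>t L\<close> cannot cover \<open>S\<close>, as \<open>S\<close> would then be compact.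
\<close>

lemma many_disjoint_translates:
  assumes S: "closedin T S" "\<not> compactin T S" and Q: "compactin T Q"
    and E: "E \<subseteq> (\<lambda>g. g <# H) ` Q" "E \<noteq> {}"
  shows "\<exists>F. finite F \<and> card F = n \<and> F \<subseteq> S \<and> disjoint_family_on (\<lambda>s. translate s E) F"
proof (induction n)
  case 0
  show ?case
    by (rule exI[of _ "{}"]) (simp add: disjoint_family_on_def)
next
  case (Suc n)
  then obtain F where F: "finite F" "card F = n" "F \<subseteq> S" "disjoint_family_on (\<lambda>s. translate s E) F"
    by blast
  have S_carrier: "S \<subseteq> carrier G" and Q_carrier: "Q \<subseteq> carrier G"
    using closedin_subset[OF S(1)] compactin_subset_topspace[OF Q] by (auto simp: topspace_eq_carrier)
  define L where "L = (\<lambda>(x, h, y). x \<otimes> (h \<otimes> inv y)) ` (Q \<times> H \<times> Q)"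
  have "continuous_map (prod_topology T (prod_topology T T)) T (\<lambda>z. fst z \<otimes> (fst (snd z) \<otimes> inv (snd (snd z))))"
    by (intro continuous_mult continuous_inv continuous_map_fst
        continuous_map_compose[OF continuous_map_snd continuous_map_fst, unfolded o_def]
        continuous_map_compose[OF continuous_map_snd continuous_map_snd, unfolded o_def])
  moreover have "compactin (prod_topology T (prod_topology T T)) (Q \<times> H \<times> Q)"
    using Q compact_H by (simp add: compactin_Times)
  ultimately have "compactin T ((\<lambda>z. fst z \<otimes> (fst (snd z) \<otimes> inv (snd (snd z)))) ` (Q \<times> H \<times> Q))"
    by (rule image_compactin[rotated])
  then have L: "compactin T L"
    by (simp add: L_def case_prod_unfold)
  then have L_carrier: "L \<subseteq> carrier G"
    using compactin_subset_topspace topspace_eq_carrier by blast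
  have "compactin T (\<Union>t\<in>F. (\<lambda>l. t \<otimes> l) ` L)"
    using F(1,3) S_carrier
    by (intro compactin_Union) (auto intro!: image_compactin[OF L] continuous_mult continuous_const continuous_ident)
  then have "\<not> S \<subseteq> (\<Union>t\<in>F. (\<lambda>l. t \<otimes> l) ` L)"
    using S closed_compactin by blast
  then obtain s where s: "s \<in> S" "\<And>t. t \<in> F \<Longrightarrow> s \<notin> (\<lambda>l. t \<otimes> l) ` L"
    by blast
  have disj: "translate s E \<inter> translate t E = {}" if t: "t \<in> F" for t
  proof (rule ccontr)
    assume "translate s E \<inter> translate t E \<noteq> {}"
    then obtain q q' where q: "q \<in> Q" "q' \<in> Q" "s <# (q <# H) = t <# (q' <# H)"
      using E(1) unfolding translate_def by blast
    have carr: "s \<in> carrier G" "t \<in> carrier G" "q \<in> carrier G" "q' \<in> carrier G"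
      using s(1) t F(3) S_carrier Q_carrier q by auto
    then have "(t \<otimes> q') <# H = (s \<otimes> q) <# H"
      using q(3) by (simp add: act_coset)
    then obtain h where h: "h \<in> H" "t \<otimes> q' \<otimes> h = s \<otimes> q"
      using coset_eq_iff[of "t \<otimes> q'" "s \<otimes> q"] carr by auto
    have "s = s \<otimes> q \<otimes> inv q"
      using carr by (simp add: m_assoc)
    also have "\<dots> = t \<otimes> (q' \<otimes> (h \<otimes> inv q))"
      using carr h H_carrier by (simp add: m_assoc subset_iff flip: h(2))
    finally have "s \<in> (\<lambda>l. t \<otimes> l) ` L"
      unfolding L_def using q h by force
    then show False
      using s(2) t by blast
  qed
  have "translate s E \<noteq> {}"
    using E(2) by (simp add: translate_def)
  then have "s \<notin> F"
    using disj[of s] by auto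
  then have "finite (insert s F) \<and> card (insert s F) = Suc n \<and> insert s F \<subseteq> S \<and>
      disjoint_family_on (\<lambda>s. translate s E) (insert s F)"
    using F s(1) disj by (auto simp: disjoint_family_on_insert)
  then show ?case
    by blast
qed

text \<open>
  Otherwise all translates by elements of \<open>S\<close> lie in \<open>A\<close> up to null sets, and arbitrarily many of
  them contain disjoint pieces of the same positive measure.
\<close>

lemma translate_escapes:
  assumes S: "closedin T S" "\<not> compactin T S"
    and E: "openin X E" "0 < emeasure \<mu> E" "emeasure \<mu> E < \<infinity>"
    and A: "A \<in> sets \<mu>" "emeasure \<mu> A < \<infinity>"
  shows "\<exists>s\<in>S. 0 < emeasure \<mu> (translate s E - A)"
proof (rule ccontr)
  assume "\<not> ?thesis"
  then have null: "emeasure \<mu> (translate s E - A) = 0" if "s \<in> S" for s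
    using that by (auto simp: zero_less_iff_neq_zero)
  have S_carrier: "S \<subseteq> carrier G"
    using closedin_subset[OF S(1)] by (simp add: topspace_eq_carrier)
  obtain E' V Q where E': "openin X E'" "E' \<subseteq> E" "compactin T Q"
    "E' \<subseteq> (\<lambda>g. g <# H) ` Q" "emeasure \<mu> (E - E') < emeasure \<mu> E"
    by (rule inner_shrinking[OF E(1,3,2)]) (rule that)
  have pos: "emeasure \<mu> E' \<noteq> 0"
  proof
    assume "emeasure \<mu> E' = 0"
    then have "emeasure \<mu> (E - E') = emeasure \<mu> E"
      using open_sets E(1) E'(1) by (intro emeasure_Diff_null_set) auto
    then show False
      using E'(5) by simp
  qed
  then have "E' \<noteq> {}"
    by auto
  have bound: "of_nat n * emeasure \<mu> E' \<le> emeasure \<mu> A" for n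
  proof -
    obtain F where F: "finite F" "card F = n" "F \<subseteq> S" "disjoint_family_on (\<lambda>s. translate s E') F"
      using many_disjoint_translates[OF S E'(3,4) \<open>E' \<noteq> {}\<close>] by blast
    have meas: "translate s E' \<in> sets \<mu>" "translate s E \<in> sets \<mu>" if "s \<in> F" for s
      using that F(3) S_carrier by (auto intro!: open_sets openin_translate E'(1) E(1))
    have rest: "(\<Union>s\<in>F. translate s E - A) \<in> sets \<mu>"
      by (intro sets.finite_UN F(1) sets.Diff meas A(1))
    have "of_nat n * emeasure \<mu> E' = (\<Sum>s\<in>F. emeasure \<mu> (translate s E'))"
      using F S_carrier open_sets[OF E'(1)] by (simp add: emeasure_translate subset_iff)
    also have "\<dots> = emeasure \<mu> (\<Union>s\<in>F. translate s E')"
      using F meas by (intro sum_emeasure) auto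
    also have "\<dots> \<le> emeasure \<mu> (A \<union> (\<Union>s\<in>F. translate s E - A))"
      using translate_mono[OF E'(2)] by (intro emeasure_mono sets.Un rest A(1)) blast
    also have "\<dots> \<le> emeasure \<mu> A + emeasure \<mu> (\<Union>s\<in>F. translate s E - A)"
      by (intro emeasure_subadditive rest A(1))
    also have "emeasure \<mu> (\<Union>s\<in>F. translate s E - A) \<le> (\<Sum>s\<in>F. emeasure \<mu> (translate s E - A))"
      using F(1) meas A(1) by (intro emeasure_subadditive_finite) auto
    also have "\<dots> = 0"
      using F(3) null by (intro sum.neutral) auto
    finally show ?thesis
      by simp
  qed
  then have "emeasure \<mu> E' < \<infinity>"
    using bound[of 1] A(2) by auto
  then obtain a where a: "emeasure \<mu> E' = ennreal a" "0 \<le> a"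
    by (cases "emeasure \<mu> E'") auto
  obtain b where b: "emeasure \<mu> A = ennreal b" "0 \<le> b"
    using A(2) by (cases "emeasure \<mu> A") auto
  have "a > 0"
    using pos a by (cases "a = 0") auto
  then obtain n where "b < of_nat n * a"
    using reals_Archimedean3 by blast
  moreover have "of_nat n * a \<le> b"
    using bound[of n] a b by (simp add: ennreal_of_nat_eq_real_of_nat flip: ennreal_mult)
  ultimately show False
    by simp
qed

text \<open>
  The sets where \<open>\<phi> s = \<mu>(s E - A)\<close> is less than \<open>\<epsilon>\<close>, and where it is positive, are open and cover the
  identity component. The first one contains the identity, the second one meets the component by
  \<open>translate_escapes\<close>. By connectedness they have a common point in it.
\<close>

lemma small_escaping_translate:
  assumes noncompact: "\<not> compactin T (identity_component G T)"
    and E: "openin X E" "0 < emeasure \<mu> E"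
    and A: "openin X A" "emeasure \<mu> A < \<infinity>" "E \<subseteq> A" and \<epsilon>: "0 < (\<epsilon> :: ennreal)"
  obtains s where "s \<in> carrier G" "0 < emeasure \<mu> (translate s E - A)"
    "emeasure \<mu> (translate s E - A) < \<epsilon>"
proof -
  define G0 where "G0 = identity_component G T"
  define \<phi> where "\<phi> s = emeasure \<mu> (translate s E - A)" for s
  have E_fin: "emeasure \<mu> E < \<infinity>"
    using emeasure_mono[OF A(3) open_sets[OF A(1)]] A(2) by auto
  have \<phi>_fin: "\<phi> s < \<infinity>" if "s \<in> carrier G" for s
  proof -
    have "\<phi> s \<le> emeasure \<mu> (translate s E)"
      unfolding \<phi>_def using that by (intro emeasure_mono open_sets openin_translate E) auto
    then show ?thesis
      using E_fin that by (simp add: emeasure_translate open_sets E)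
  qed
  have \<phi>_le: "\<phi> s \<le> \<phi> t + emeasure \<mu> (translate s E - translate t E)"
    if "s \<in> carrier G" "t \<in> carrier G" for s t
  proof -
    have meas: "translate s E \<in> sets \<mu>" "translate t E \<in> sets \<mu>" "A \<in> sets \<mu>"
      using that by (auto intro!: open_sets openin_translate E A)
    have "\<phi> s \<le> emeasure \<mu> ((translate t E - A) \<union> (translate s E - translate t E))"
      unfolding \<phi>_def using meas by (intro emeasure_mono) auto
    also have "\<dots> \<le> \<phi> t + emeasure \<mu> (translate s E - translate t E)"
      unfolding \<phi>_def using meas by (intro emeasure_subadditive) auto
    finally show ?thesis .
  qed
  let ?O1 = "{s \<in> carrier G. \<phi> s < \<epsilon>}" and ?O2 = "{s \<in> carrier G. 0 < \<phi> s}"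
  have O1: "openin T ?O1"
  proof (subst openin_subopen, intro ballI)
    fix s
    assume s: "s \<in> ?O1"
    then have "0 < \<epsilon> - \<phi> s" and s_carrier: "s \<in> carrier G"
      by (auto intro: diff_gr0_ennreal)
    then obtain U where U: "openin T U" "s \<in> U"
      "\<And>t. t \<in> U \<Longrightarrow> emeasure \<mu> (translate t E - translate s E) < \<epsilon> - \<phi> s"
      "\<And>t. t \<in> U \<Longrightarrow> emeasure \<mu> (translate s E - translate t E) < \<epsilon> - \<phi> s"
      by (rule translate_continuous[OF E(1) E_fin]) (rule that)
    have "\<phi> t < \<epsilon>" if "t \<in> U" for t
    proof -
      have "\<phi> t \<le> \<phi> s + emeasure \<mu> (translate t E - translate s E)"
        using that s open_carrier[OF U(1)] by (intro \<phi>_le) auto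
      also have "\<dots> < \<phi> s + (\<epsilon> - \<phi> s)"
        using U(3)[OF that] s \<phi>_fin[of s] by (simp add: ennreal_add_left_cancel_less)
      also have "\<dots> = \<epsilon>"
        using s by (simp add: add_diff_inverse_ennreal less_imp_le)
      finally show ?thesis .
    qed
    then show "\<exists>U. openin T U \<and> s \<in> U \<and> U \<subseteq> ?O1"
      using U open_carrier[OF U(1)] by (intro exI[of _ U]) auto
  qed
  have O2: "openin T ?O2"
  proof (subst openin_subopen, intro ballI)
    fix s
    assume s: "s \<in> ?O2"
    then have "0 < \<phi> s" "s \<in> carrier G"
      by auto
    then obtain U where U: "openin T U" "s \<in> U"
      "\<And>t. t \<in> U \<Longrightarrow> emeasure \<mu> (translate t E - translate s E) < \<phi> s"
      "\<And>t. t \<in> U \<Longrightarrow> emeasure \<mu> (translate s E - translate t E) < \<phi> s"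
      by (rule translate_continuous[OF E(1) E_fin]) (rule that)
    have "0 < \<phi> t" if "t \<in> U" for t
    proof (rule ccontr)
      assume "\<not> 0 < \<phi> t"
      then have "\<phi> s \<le> emeasure \<mu> (translate s E - translate t E)"
        using \<phi>_le[of s t] that s open_carrier[OF U(1)] by auto
      then show False
        using U(4)[OF that] by simp
    qed
    then show "\<exists>U. openin T U \<and> s \<in> U \<and> U \<subseteq> ?O2"
      using U open_carrier[OF U(1)] by (intro exI[of _ U]) auto
  qed
  have conn: "connectedin T G0" and closed: "closedin T G0"
    by (simp_all add: G0_def identity_component_def connectedin_connected_component_of
        closedin_connected_component_of)
  have G0_carrier: "G0 \<subseteq> carrier G"
    using closedin_subset[OF closed] by (simp add: topspace_eq_carrier)
  have "E - A = {}"
    using A(3) by blast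
  then have "\<one> \<in> ?O1"
    using \<epsilon> by (simp add: \<phi>_def translate_one[OF open_subset_cosets[OF E(1)]] \<open>E - A = {}\<close>)
  moreover have "\<one> \<in> G0"
    by (simp add: G0_def identity_component_def connected_component_of_refl topspace_eq_carrier)
  ultimately have meet1: "?O1 \<inter> G0 \<noteq> {}"
    by blast
  have "\<exists>s\<in>G0. 0 < \<phi> s"
    unfolding \<phi>_def
    using noncompact by (intro translate_escapes closed E E_fin open_sets A) (simp add: G0_def)
  then have meet2: "?O2 \<inter> G0 \<noteq> {}"
    using G0_carrier by blast
  have "G0 \<subseteq> ?O1 \<union> ?O2"
    using G0_carrier \<epsilon> by (auto simp: zero_less_iff_neq_zero)
  then have "?O1 \<inter> ?O2 \<inter> G0 \<noteq> {}"
    using conn[unfolded connectedin, THEN conjunct2, simplified not_ex, rule_format, of ?O1 ?O2]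
      O1 O2 meet1 meet2 by argo
  then obtain s where "s \<in> carrier G" "0 < \<phi> s" "\<phi> s < \<epsilon>"
    by blast
  then show ?thesis
    by (intro that[of s]) (simp_all add: \<phi>_def)
qed

end

section \<open>Orthogonality relations and the support of wavelet transforms\<close>

locale square_integrable_system = homogeneous_measure_space +
  fixes \<pi> :: "'a set \<Rightarrow> 'h::chilbert_space \<Rightarrow> 'h" and \<xi> :: 'h
  assumes rep: "unitary_rep G T H \<pi>"
    and irreducible: "irreducible_rep G H \<pi>"
    and admissible: "admissible_wavelet \<mu> \<pi> \<xi>"
begin

abbreviation W :: "'h \<Rightarrow> 'a set \<Rightarrow> complex" where
  "W \<equiv> wavelet_transform \<pi> \<xi>"

definition supp :: "'h \<Rightarrow> 'a set set" where
  "supp \<eta> = {C \<in> lcosets H. W \<eta> C \<noteq> 0}"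

definition energy :: "'h \<Rightarrow> ennreal" where
  "energy \<eta> = (\<integral>\<^sup>+ C. ennreal ((cmod (W \<eta> C))\<^sup>2) \<partial>\<mu>)"

lemma unitary: "C \<in> lcosets H \<Longrightarrow> unitary_operator (\<pi> C)"
  using rep by (simp add: unitary_rep_def)

lemma cinner_unitary: "C \<in> lcosets H \<Longrightarrow> cinner (\<pi> C x) (\<pi> C y) = cinner x y"
  using unitary by (simp add: unitary_operator_def)

lemma W_add: "W (x + y) C = W x C + W y C"
  by (simp add: wavelet_transform_def cinner_add_left)

lemma W_diff: "W (x - y) C = W x C - W y C"
  by (simp add: wavelet_transform_def cinner_diff_left)

lemma W_scaleC: "W (a *\<^sub>C x) C = a * W x C"
  by (simp add: wavelet_transform_def cinner_scaleC_left)

lemma W_scaleR: "W (r *\<^sub>R x) C = of_real r * W x C"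
  by (simp add: wavelet_transform_def cinner_scaleR_left)

lemma W_sum: "W (\<Sum>i\<in>I. f i) C = (\<Sum>i\<in>I. W (f i) C)"
  by (simp add: wavelet_transform_def cinner_sum_left)

lemma W_zero: "W 0 C = 0"
  by (simp add: wavelet_transform_def)

lemma continuous_W: "continuous_map X euclidean (W \<eta>)"
proof -
  have "continuous_map X euclidean (\<lambda>C. cinner (\<pi> C \<xi>) \<eta>)"
    using rep by (simp add: unitary_rep_def)
  moreover have "continuous_map euclidean euclidean cnj"
    by (simp add: continuous_on_cnj)
  ultimately have "continuous_map X euclidean (cnj \<circ> (\<lambda>C. cinner (\<pi> C \<xi>) \<eta>))"
    by (rule continuous_map_compose)
  moreover have "cnj \<circ> (\<lambda>C. cinner (\<pi> C \<xi>) \<eta>) = W \<eta>"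
    by (rule ext) (simp add: wavelet_transform_def cinner_commute[of \<eta>])
  ultimately show ?thesis
    by simp
qed

lemma open_preimage_W:
  assumes "open S"
  shows "openin X {C \<in> lcosets H. W \<eta> C \<in> S}"
  using openin_continuous_map_preimage[OF continuous_W, of S \<eta>] assms
  by (simp add: topspace_coset_topology)

lemma open_supp: "openin X (supp \<eta>)"
  using open_preimage_W[of "- {0}" \<eta>] by (simp add: supp_def open_Compl)

lemma measurable_W [measurable]: "W \<eta> \<in> borel_measurable \<mu>"
proof (rule borel_measurableI)
  fix S :: "complex set"
  assume "open S"
  moreover have "W \<eta> -` S \<inter> space \<mu> = {C \<in> lcosets H. W \<eta> C \<in> S}"
    by (auto simp: space_mu)
  ultimately show "W \<eta> -` S \<inter> space \<mu> \<in> sets \<mu>"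
    using open_preimage_W open_sets by simp
qed

text \<open>
  Apply the unitary \<open>\<pi>(s H)\<close> to both entries of \<open>\<langle>\<eta>, \<pi>(s\<^sup>-\<^sup>1 C) \<xi>\<rangle>\<close>.
\<close>

lemma W_covariant:
  assumes s: "s \<in> carrier G" and C: "C \<in> lcosets H"
  shows "W (\<pi> (s <# H) \<eta>) C = W \<eta> (inv s <# C)"
proof -
  obtain g where g: "g \<in> carrier G" "C = g <# H"
    using C by (rule cosetE)
  have "\<pi> ((s \<otimes> (inv s \<otimes> g)) <# H) = \<pi> (s <# H) \<circ> \<pi> ((inv s \<otimes> g) <# H)"
    using rep s g(1) by (simp only: unitary_rep_def m_closed inv_closed)
  moreover have "s \<otimes> (inv s \<otimes> g) = g"
    using s g(1) by (simp add: m_assoc[symmetric])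
  ultimately have "\<pi> C = \<pi> (s <# H) \<circ> \<pi> (inv s <# C)"
    using s g by (simp add: act_coset)
  then show ?thesis
    by (simp add: wavelet_transform_def cinner_unitary[OF coset_in[OF s]])
qed

lemma supp_translate:
  assumes "s \<in> carrier G"
  shows "supp (\<pi> (s <# H) \<eta>) = translate s (supp \<eta>)"
proof -
  have "supp \<eta> \<subseteq> lcosets H"
    by (auto simp: supp_def)
  then show ?thesis
    using assms by (auto simp: mem_translate W_covariant supp_def act_in)
qed

lemma energy_invariant:
  assumes "C \<in> lcosets H"
  shows "energy (\<pi> C \<eta>) = energy \<eta>"
proof -
  obtain s where s: "s \<in> carrier G" "C = s <# H"
    using assms by (rule cosetE)
  have "energy (\<pi> C \<eta>) = (\<integral>\<^sup>+ D. ennreal ((cmod (W \<eta> (inv s <# D)))\<^sup>2) \<partial>\<mu>)"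
    unfolding energy_def s(2) by (intro nn_integral_cong) (simp add: W_covariant[OF s(1)] space_mu)
  also have "\<dots> = energy \<eta>"
    unfolding energy_def using s(1) by (intro nn_integral_translate[where f = "\<lambda>D. ennreal ((cmod (W \<eta> D))\<^sup>2)"]) auto
  finally show ?thesis .
qed

lemma energy_scaleC: "energy (a *\<^sub>C \<eta>) = ennreal ((cmod a)\<^sup>2) * energy \<eta>"
  by (simp add: energy_def W_scaleC norm_mult power_mult_distrib ennreal_mult flip: nn_integral_cmult)

lemma energy_parallelogram: "energy (x + y) + energy (x - y) = 2 * energy x + 2 * energy y"
proof -
  have "energy (x + y) + energy (x - y) =
      (\<integral>\<^sup>+ C. ennreal ((cmod (W (x + y) C))\<^sup>2) + ennreal ((cmod (W (x - y) C))\<^sup>2) \<partial>\<mu>)"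
    unfolding energy_def by (rule nn_integral_add[symmetric]) auto
  also have "\<dots> = (\<integral>\<^sup>+ C. 2 * ennreal ((cmod (W x C))\<^sup>2) + 2 * ennreal ((cmod (W y C))\<^sup>2) \<partial>\<mu>)"
  proof (rule nn_integral_cong)
    fix C
    have "(cmod (W (x + y) C))\<^sup>2 + (cmod (W (x - y) C))\<^sup>2 = 2 * (cmod (W x C))\<^sup>2 + 2 * (cmod (W y C))\<^sup>2"
      unfolding W_add W_diff cmod_power2 by (simp add: power2_eq_square algebra_simps)
    then have "ennreal ((cmod (W (x + y) C))\<^sup>2 + (cmod (W (x - y) C))\<^sup>2) =
        ennreal (2 * (cmod (W x C))\<^sup>2 + 2 * (cmod (W y C))\<^sup>2)"
      by simp
    then show "ennreal ((cmod (W (x + y) C))\<^sup>2) + ennreal ((cmod (W (x - y) C))\<^sup>2) =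
        2 * ennreal ((cmod (W x C))\<^sup>2) + 2 * ennreal ((cmod (W y C))\<^sup>2)"
      by (simp add: ennreal_plus ennreal_mult)
  qed
  also have "\<dots> = 2 * energy x + 2 * energy y"
    unfolding energy_def by (subst nn_integral_add) (auto simp: nn_integral_cmult)
  finally show ?thesis .
qed

text \<open>
  Fatou's lemma, as the transforms converge pointwise.
\<close>

lemma energy_lsc:
  assumes lim: "x \<longlonglongrightarrow> l" and bound: "\<And>n. energy (x n) \<le> M"
  shows "energy l \<le> M"
proof -
  have conv: "(\<lambda>n. ennreal ((cmod (W (x n) C))\<^sup>2)) \<longlonglongrightarrow> ennreal ((cmod (W l C))\<^sup>2)" for C
  proof -
    have "(\<lambda>n. W (x n) C - W l C) \<longlonglongrightarrow> 0"
    proof (rule Lim_null_comparison)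
      show "\<forall>\<^sub>F n in sequentially. norm (W (x n) C - W l C) \<le> norm (x n - l) * norm (\<pi> C \<xi>)"
        unfolding W_diff[symmetric] by (simp add: wavelet_transform_def cinner_cauchy_schwarz)
      have "(\<lambda>n. norm (x n - l)) \<longlonglongrightarrow> 0"
        using lim LIM_zero tendsto_norm_zero by blast
      then show "(\<lambda>n. norm (x n - l) * norm (\<pi> C \<xi>)) \<longlonglongrightarrow> 0"
        by (rule tendsto_mult_left_zero)
    qed
    then have "(\<lambda>n. W (x n) C) \<longlonglongrightarrow> W l C"
      by (rule LIM_zero_cancel)
    then show ?thesis
      by (intro tendsto_ennrealI tendsto_power tendsto_norm)
  qed
  have "energy l = (\<integral>\<^sup>+ C. liminf (\<lambda>n. ennreal ((cmod (W (x n) C))\<^sup>2)) \<partial>\<mu>)"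
    unfolding energy_def by (intro nn_integral_cong lim_imp_Liminf[OF _ conv, symmetric]) simp
  also have "\<dots> \<le> liminf (\<lambda>n. energy (x n))"
    unfolding energy_def by (rule nn_integral_liminf) simp
  also have "\<dots> \<le> liminf (\<lambda>n. M)"
    by (rule Liminf_mono) (simp add: bound)
  finally show ?thesis
    by (simp add: Liminf_const)
qed

lemma energy_form: "closed_quadratic_form {x. energy x < \<infinity>} (\<lambda>x. enn2real (energy x))"
proof
  have par: "energy (x + y) < \<infinity> \<and> energy (x - y) < \<infinity>" if "energy x < \<infinity>" "energy y < \<infinity>" for x y
  proof -
    have "energy (x + y) + energy (x - y) < \<infinity>"
      unfolding energy_parallelogram using that by (simp add: ennreal_mult_less_top)
    then show ?thesis
      by simp
  qed
  have en: "energy x = ennreal (enn2real (energy x))" if "energy x < \<infinity>" for x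
    using that by simp
  show "0 \<in> {x. energy x < \<infinity>}"
    by (simp add: energy_def W_zero)
  show "x + y \<in> {x. energy x < \<infinity>}" if "x \<in> {x. energy x < \<infinity>}" "y \<in> {x. energy x < \<infinity>}" for x y
    using that par by simp
  show "a *\<^sub>C x \<in> {x. energy x < \<infinity>}" if "x \<in> {x. energy x < \<infinity>}" for a x
    using that by (simp add: energy_scaleC ennreal_mult_less_top)
  show "0 \<le> enn2real (energy x)" for x
    by simp
  show "enn2real (energy (a *\<^sub>C x)) = (cmod a)\<^sup>2 * enn2real (energy x)" for a x
    by (simp add: energy_scaleC enn2real_mult)
  show "enn2real (energy (x + y)) + enn2real (energy (x - y)) =
      2 * enn2real (energy x) + 2 * enn2real (energy y)"
    if "x \<in> {x. energy x < \<infinity>}" "y \<in> {x. energy x < \<infinity>}" for x y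
  proof -
    have "enn2real (energy (x + y) + energy (x - y)) = enn2real (2 * energy x + 2 * energy y)"
      by (simp only: energy_parallelogram)
    then show ?thesis
      using that par[of x y] by (simp add: enn2real_plus enn2real_mult ennreal_mult_less_top)
  qed
  show "closed {x \<in> {x. energy x < \<infinity>}. enn2real (energy x) \<le> M}" for M
    unfolding closed_sequential_limits
  proof (intro allI impI, elim conjE)
    fix x l
    assume x: "\<forall>n. x n \<in> {x \<in> {x. energy x < \<infinity>}. enn2real (energy x) \<le> M}" and lim: "x \<longlonglongrightarrow> l"
    have "0 \<le> enn2real (energy (x 0))" "enn2real (energy (x 0)) \<le> M"
      using x by auto
    then have "0 \<le> M"
      by linarith
    have "energy (x n) \<le> ennreal M" for n
      using x en[of "x n"] \<open>0 \<le> M\<close> by (metis (mono_tags, lifting) ennreal_leI mem_Collect_eq)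
    then have le: "energy l \<le> ennreal M"
      by (rule energy_lsc[OF lim])
    then have "energy l < \<infinity>"
      using ennreal_less_top le_less_trans infinity_ennreal_def by metis
    then show "l \<in> {x \<in> {x. energy x < \<infinity>}. enn2real (energy x) \<le> M}"
      using enn2real_leI[OF \<open>0 \<le> M\<close> le] by simp
  qed
qed

lemma orthogonality_relation:
  obtains c where "c > 0" "\<And>\<eta>. energy \<eta> = ennreal (c * (norm \<eta>)\<^sup>2)"
proof -
  interpret form: closed_quadratic_form "{x. energy x < \<infinity>}" "\<lambda>x. enn2real (energy x)"
    by (rule energy_form)
  have energy_\<xi>: "energy \<xi> > 0" "energy \<xi> < \<infinity>"
    using admissible by (auto simp: admissible_wavelet_def wavelet_const_def energy_def wavelet_transform_def)
  have "\<xi> \<noteq> 0"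
    using energy_\<xi>(1) by (auto simp: energy_def wavelet_transform_def)
  have irr: "irreducible_family (\<pi> ` (lcosets H))"
    using irreducible unitary_operator_bounded_linear[OF unitary]
    by (auto simp: irreducible_family_def irreducible_rep_def)
  have "{x. energy x < \<infinity>} = UNIV \<and> (\<exists>c. \<forall>x. enn2real (energy x) = c * (norm x)\<^sup>2)"
    by (rule form.invariant_form_scalar[OF irr _ _ _ _ \<open>\<xi> \<noteq> 0\<close>])
      (use unitary energy_invariant energy_\<xi> in auto)
  then obtain c where c: "\<And>x. energy x < \<infinity>" "\<And>x. enn2real (energy x) = c * (norm x)\<^sup>2"
    by blast
  then have eq: "energy x = ennreal (c * (norm x)\<^sup>2)" for x
    by (metis ennreal_enn2real infinity_ennreal_def)
  have "0 < c * (norm \<xi>)\<^sup>2"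
    using energy_\<xi>(1) unfolding eq by simp
  then have "c > 0"
    using zero_less_mult_pos2 \<open>\<xi> \<noteq> 0\<close> by (metis zero_less_norm_iff zero_less_power)
  then show ?thesis
    using eq that by blast
qed

definition orthonormal_supported :: "nat \<Rightarrow> (nat \<Rightarrow> 'h) \<Rightarrow> 'a set set \<Rightarrow> bool" where
  "orthonormal_supported n e A \<longleftrightarrow>
     (\<forall>i<n. \<forall>j<n. cinner (e i) (e j) = (if i = j then 1 else 0)) \<and> (\<forall>i<n. supp (e i) \<subseteq> A)"

text \<open>
  Integrate Bessel's inequality for the vector \<open>\<pi>(C) \<xi>\<close>, whose norm is \<open>\<parallel>\<xi>\<parallel>\<close>, over \<open>A\<close>.
\<close>

lemma trace_bound:
  assumes c: "\<And>\<eta>. energy \<eta> = ennreal (c * (norm \<eta>)\<^sup>2)"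
    and e: "orthonormal_supported n e A" and A: "A \<in> sets \<mu>"
  shows "of_nat n * ennreal c \<le> ennreal ((norm \<xi>)\<^sup>2) * emeasure \<mu> A"
proof -
  have norm_e: "(norm (e i))\<^sup>2 = 1" if "i < n" for i
    using e that by (simp add: orthonormal_supported_def rinner_def flip: rinner_self)
  have "of_nat n * ennreal c = (\<Sum>i<n. energy (e i))"
    by (simp add: c norm_e)
  also have "\<dots> = (\<integral>\<^sup>+ C. (\<Sum>i<n. ennreal ((cmod (W (e i) C))\<^sup>2)) \<partial>\<mu>)"
    unfolding energy_def by (rule nn_integral_sum[symmetric]) simp
  also have "\<dots> \<le> (\<integral>\<^sup>+ C. ennreal ((norm \<xi>)\<^sup>2) * indicator A C \<partial>\<mu>)"
  proof (rule nn_integral_mono)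
    fix C
    assume "C \<in> space \<mu>"
    then have C: "C \<in> lcosets H"
      by (simp add: space_mu)
    show "(\<Sum>i<n. ennreal ((cmod (W (e i) C))\<^sup>2)) \<le> ennreal ((norm \<xi>)\<^sup>2) * indicator A C"
    proof (cases "C \<in> A")
      case True
      have "(\<Sum>i<n. (cmod (W (e i) C))\<^sup>2) \<le> (norm (\<pi> C \<xi>))\<^sup>2"
        unfolding wavelet_transform_def
        by (rule bessel_inequality) (use e in \<open>simp add: orthonormal_supported_def\<close>)
      then show ?thesis
        using True by (simp add: unitary_operator_norm[OF unitary[OF C]] sum_ennreal ennreal_leI)
    next
      case False
      then have "W (e i) C = 0" if "i < n" for i
        using e C that by (auto simp: orthonormal_supported_def supp_def)
      then show ?thesis
        by simp
    qed
  qed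
  also have "\<dots> = ennreal ((norm \<xi>)\<^sup>2) * emeasure \<mu> A"
    using A by (rule nn_integral_cmult_indicator)
  finally show ?thesis .
qed

text \<open>
  One Gram-Schmidt step. Outside of \<open>A\<close> the transform of \<open>v\<close> does not change when combinations of the
  \<open>e\<^sub>i\<close> are subtracted, so the remainder is nonzero because the support of \<open>v\<close> is not contained in \<open>A\<close>.
\<close>

lemma orthonormal_supported_extend:
  assumes e: "orthonormal_supported n e A"
    and v: "supp v \<subseteq> B" "\<not> supp v \<subseteq> A" and "A \<subseteq> B"
  shows "\<exists>e'. orthonormal_supported (Suc n) e' B"
proof -
  define r where "r = v - (\<Sum>i<n. cinner v (e i) *\<^sub>C e i)"
  have W_e: "W (e i) C = 0" if "i < n" "C \<in> lcosets H" "C \<notin> A" for i C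
    using that e by (auto simp: orthonormal_supported_def supp_def)
  have W_r: "W r C = W v C" if "C \<in> lcosets H" "C \<notin> A" for C
    using W_e that by (simp add: r_def W_diff W_sum W_scaleC)
  have "r \<noteq> 0"
    using v(2) W_r by (auto simp: supp_def W_zero)
  have supp_r: "supp r \<subseteq> B"
  proof
    fix C
    assume C: "C \<in> supp r"
    show "C \<in> B"
    proof (cases "C \<in> A")
      case False
      then have "C \<in> supp v"
        using C W_r[of C] by (auto simp: supp_def)
      then show ?thesis
        using v(1) by blast
    qed (use \<open>A \<subseteq> B\<close> in blast)
  qed
  have orth: "cinner r (e j) = 0" if "j < n" for j
  proof -
    have "(\<Sum>i<n. cinner v (e i) * cinner (e i) (e j)) = (\<Sum>i<n. if i = j then cinner v (e i) else 0)"
      using e that by (intro sum.cong) (auto simp: orthonormal_supported_def)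
    also have "\<dots> = cinner v (e j)"
      using that by simp
    finally show ?thesis
      by (simp add: r_def cinner_diff_left cinner_sum_left cinner_scaleC_left)
  qed
  define u where "u = (1 / norm r) *\<^sub>R r"
  have u_self: "cinner u u = 1"
    unfolding cinner_self u_def using \<open>r \<noteq> 0\<close> by simp
  have u_orth: "cinner u (e j) = 0" "cinner (e j) u = 0" if "j < n" for j
    using orth[OF that] cinner_commute[of "e j" u] by (simp_all add: u_def cinner_scaleR_left)
  have supp_u: "supp u \<subseteq> B"
    using supp_r by (auto simp: supp_def u_def W_scaleR)
  moreover have "supp (e i) \<subseteq> B" if "i < n" for i
    using e that \<open>A \<subseteq> B\<close> unfolding orthonormal_supported_def by blast
  ultimately have "orthonormal_supported (Suc n) (e(n := u)) B"
    using e u_self u_orth supp_u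
    unfolding orthonormal_supported_def less_Suc_eq by auto
  then show ?thesis
    by blast
qed

text \<open>
  Any bound on the measures of the growing sets would do; \<open>\<mu>(E) + 1\<close> exceeds \<open>\<mu>(E)\<close> strictly because
  \<open>\<mu>(E)\<close> is finite, and then each step may use up part of what is left below the bound.
\<close>

theorem support_infinite:
  assumes noncompact: "\<not> compactin T (identity_component G T)" and "\<eta> \<noteq> 0"
  shows "emeasure \<mu> (supp \<eta>) = \<infinity>"
proof (rule ccontr)
  define E where "E = supp \<eta>"
  assume "emeasure \<mu> (supp \<eta>) \<noteq> \<infinity>"
  then have fin: "emeasure \<mu> E < \<infinity>"
    by (simp add: E_def less_top)
  have E: "openin X E"
    by (simp add: E_def open_supp)
  obtain c where c: "c > 0" "\<And>\<eta>. energy \<eta> = ennreal (c * (norm \<eta>)\<^sup>2)"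
    using orthogonality_relation by blast
  have "\<not> supp \<eta> \<subseteq> {}"
  proof
    assume "supp \<eta> \<subseteq> {}"
    then have "energy \<eta> = (\<integral>\<^sup>+ C. 0 \<partial>\<mu>)"
      unfolding energy_def by (intro nn_integral_cong) (auto simp: supp_def space_mu)
    then have "ennreal (c * (norm \<eta>)\<^sup>2) = 0"
      by (simp add: c(2))
    then have "c * (norm \<eta>)\<^sup>2 \<le> 0"
      by (simp add: ennreal_eq_0_iff)
    moreover have "0 < c * (norm \<eta>)\<^sup>2"
      using c(1) \<open>\<eta> \<noteq> 0\<close> by simp
    ultimately show False
      by simp
  qed
  moreover have "orthonormal_supported 0 (\<lambda>_. 0) {}"
    by (simp add: orthonormal_supported_def)
  ultimately obtain e1 where e1: "orthonormal_supported 1 e1 E"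
    using orthonormal_supported_extend[of 0 "\<lambda>_. 0" "{}" \<eta> E] by (auto simp: E_def)
  have pos: "0 < emeasure \<mu> E"
  proof (rule ccontr)
    assume "\<not> 0 < emeasure \<mu> E"
    then have "emeasure \<mu> E = 0"
      by simp
    then have "ennreal c \<le> 0"
      using trace_bound[OF c(2) e1 open_sets[OF E]] by simp
    then show False
      using c(1) by (simp add: ennreal_eq_0_iff)
  qed
  have families: "\<exists>A e. openin X A \<and> E \<subseteq> A \<and> emeasure \<mu> A < emeasure \<mu> E + 1 \<and> orthonormal_supported n e A" for n
  proof (induction n)
    case 0
    have "emeasure \<mu> E < emeasure \<mu> E + 1"
      using fin ennreal_add_left_cancel_less[of "emeasure \<mu> E" 0 1] by simp
    then show ?case
      using E by (intro exI[of _ E]) (simp add: orthonormal_supported_def)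
  next
    case (Suc n)
    then obtain A e where A: "openin X A" "E \<subseteq> A" "emeasure \<mu> A < emeasure \<mu> E + 1"
      and e: "orthonormal_supported n e A"
      by blast
    have A_fin: "emeasure \<mu> A < \<infinity>"
      using A(3) by (rule less_le_trans) simp
    have "0 < emeasure \<mu> E + 1 - emeasure \<mu> A"
      using A(3) by (rule diff_gr0_ennreal)
    then obtain s where s: "s \<in> carrier G" "0 < emeasure \<mu> (translate s E - A)"
      "emeasure \<mu> (translate s E - A) < emeasure \<mu> E + 1 - emeasure \<mu> A"
      by (rule small_escaping_translate[OF noncompact E pos A(1) A_fin A(2)]) (rule that)
    define B where "B = A \<union> translate s E"
    have sE: "openin X (translate s E)"
      by (rule openin_translate[OF s(1) E])
    have B: "openin X B"
      unfolding B_def by (intro openin_Un A(1) sE)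
    have "emeasure \<mu> B = emeasure \<mu> A + emeasure \<mu> (translate s E - A)"
      using plus_emeasure[of A \<mu> "translate s E - A"] open_sets[OF A(1)] open_sets[OF sE]
      by (simp add: B_def)
    also have "\<dots> < emeasure \<mu> A + (emeasure \<mu> E + 1 - emeasure \<mu> A)"
      using s(3) A_fin by (simp add: ennreal_add_left_cancel_less)
    also have "\<dots> = emeasure \<mu> E + 1"
      using A(3) by (simp add: add_diff_inverse_ennreal less_imp_le)
    finally have B_less: "emeasure \<mu> B < emeasure \<mu> E + 1" .
    have "\<not> translate s E \<subseteq> A"
    proof
      assume "translate s E \<subseteq> A"
      then have "translate s E - A = {}"
        by blast
      with s(2) show False
        by (metis emeasure_empty less_irrefl)
    qed
    then obtain e' where "orthonormal_supported (Suc n) e' B"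
      using orthonormal_supported_extend[OF e, of "\<pi> (s <# H) \<eta>" B]
      unfolding supp_translate[OF s(1)] E_def[symmetric] B_def by blast
    then show ?case
      using B B_less A(2) unfolding B_def by blast
  qed
  have bound: "of_nat n * ennreal c \<le> ennreal ((norm \<xi>)\<^sup>2) * (emeasure \<mu> E + 1)" for n
  proof -
    obtain A e where A: "openin X A" "emeasure \<mu> A < emeasure \<mu> E + 1" "orthonormal_supported n e A"
      using families by blast
    have "of_nat n * ennreal c \<le> ennreal ((norm \<xi>)\<^sup>2) * emeasure \<mu> A"
      by (rule trace_bound[OF c(2) A(3) open_sets[OF A(1)]])
    also have "\<dots> \<le> ennreal ((norm \<xi>)\<^sup>2) * (emeasure \<mu> E + 1)"
      using A(2) by (intro mult_left_mono) auto
    finally show ?thesis .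
  qed
  obtain b where b: "emeasure \<mu> E = ennreal b" "0 \<le> b"
    using fin by (cases "emeasure \<mu> E") auto
  obtain n where "(norm \<xi>)\<^sup>2 * (b + 1) < of_nat n * c"
    using reals_Archimedean3[OF c(1)] by blast
  moreover have "of_nat n * c \<le> (norm \<xi>)\<^sup>2 * (b + 1)"
  proof -
    have "ennreal (of_nat n * c) \<le> ennreal ((norm \<xi>)\<^sup>2 * (b + 1))"
      using bound[of n] c(1) b by (simp add: ennreal_mult ennreal_plus ennreal_of_nat_eq_real_of_nat)
    then show ?thesis
      using b(2) by (simp add: ennreal_le_iff)
  qed
  ultimately show False
    by simp
qed

end

theorem theorem2p3:
  fixes G :: "('g, 'm) monoid_scheme"
    and T :: "'g topology"
    and H :: "'g set"
    and \<mu> :: "'g set measure"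
    and \<pi> :: "'g set \<Rightarrow> 'h::chilbert_space \<Rightarrow> 'h"
    and \<xi> :: 'h
  assumes "locally_compact_group G T"
    and "\<not> compactin T (identity_component G T)"
    and "subgroup H G"
    and "compactin T H"
    and "invariant_radon_measure G T H \<mu>"
    and "unitary_rep G T H \<pi>"
    and "irreducible_rep G H \<pi>"
    and "square_integrable_rep \<mu> \<pi>"
    and "admissible_wavelet \<mu> \<pi> \<xi>"
  shows "\<forall>\<eta>. \<eta> \<noteq> 0 \<longrightarrow>
    emeasure \<mu> {C \<in> lcosets\<^bsub>G\<^esub> H. wavelet_transform \<pi> \<xi> \<eta> C \<noteq> 0} = \<infinity>"
proof -
  interpret locally_compact_group G T
    by fact
  interpret square_integrable_system G T H \<mu> \<pi> \<xi>
    by (intro square_integrable_system.intro homogeneous_measure_space.intro coset_space.intro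
        coset_space_axioms.intro homogeneous_measure_space_axioms.intro
        square_integrable_system_axioms.intro topological_group_axioms locally_compact assms)
  show ?thesis
    using support_infinite[OF assms(2)] by (simp add: supp_def)
qed

end
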